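(* Let $c_s>0$, $s\in\mathbb{N}$, be numbers such that $c_s/(n+|k|)^s\le\tilde e(n,k,s)$ for all $k\in\mathbb{Z}$ and $n\in\mathbb{N}$. For the non-periodic case and the normalized error criterion the following hold. (a) For $s\ge1$ and $k\in\mathbb{Z}\setminus\{0\}$, oscillatory integration becomes harder in $|k|$ asymptotically in $\varepsilon$, i.e. $n^{\rm nor}(\varepsilon,k,s)=\Theta\bigl(|k|^{1/s}\varepsilon^{-1/s}\bigr)$ as $\varepsilon\to0$. (b) For $s=1$ and fixed small $\varepsilon$ (namely, $\varepsilon\in(0,1)$ with $\varepsilon<\sqrt2\,\pi c_1$), oscillatory integration becomes harder in $|k|$, i.e. $\lim_{|k|\to\infty}n^{\rm nor}(\varepsilon,k,1)=\infty$. (c) For $s\ge2$ and fixed $\varepsilon\in(0,1)$, or even for $\varepsilon=\varepsilon_k\in(0,1)$ depending on $k$ with $\varepsilon_k^{-1}=\mathcal{O}(|k|^\eta)$ as $|k|\to\infty$ for some $\eta\in(0,s-1)$, oscillatory integration becomes easy, since $n^{\rm nor}(\varepsilon_k,k,s)\le2s$ for all sufficiently large $|k|$.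
   Context: For $s\in\mathbb{N}=\{1,2,\dots\}$ let $H^s=\{f:[0,1]\to\mathbb{C} : f^{(s-1)}\text{ is absolutely continuous},\ f^{(s)}\in L_2([0,1])\}$ with inner product $$\langle f,g\rangle_s=\sum_{\ell=0}^{s-1}\int_0^1 f^{(\ell)}(x)\,dx\ \int_0^1\overline{g^{(\ell)}(x)}\,dx+\int_0^1 f^{(s)}(x)\,\overline{g^{(s)}(x)}\,dx$$ and norm $\|f\|_{H^s}=\langle f,f\rangle_s^{1/2}$. The periodic subspace is $\widetilde H^s=\{f\in H^s : f^{(\ell)}(0)=f^{(\ell)}(1)\text{ for }\ell=0,\dots,s-1\}$ with the same inner product. For $k\in\mathbb{Z}$, $I_k(f)=\int_0^1 f(x)\,e^{-2\pi i kx}\,dx$. Algorithms using $n$ values have the form $A_n(f)=\sum_{j=1}^n a_j f^{(\ell_j)}(x_j)$ with $a_j\in\mathbb{C}$, $\ell_j\in\{0,\dots,s-1\}$, $x_j\in[0,1]$; for $n=0$ the only algorithm is $A_0=0$. Set $$e(n,k,s)=\inf_{A_n}\ \sup_{f\in H^s,\ \|f\|_{H^s}\le1}|I_k(f)-A_n(f)|,\qquad \tilde e(n,k,s)=\inf_{A_n}\ \sup_{f\in\widetilde H^s,\ \|f\|_{H^s}\le1}|I_k(f)-A_n(f)|.$$ Numbers $c_s>0$ depending only on $s$ with $c_s/(n+|k|)^s\le\tilde e(n,k,s)$ for all $k\in\mathbb{Z}$, $n\in\mathbb{N}$ are known to exist. The information complexity for the normalized error criterion is $n^{\rm nor}(\varepsilon,k,s)=\min\{n\in\{0,1,2,\dots\}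 : e(n,k,s)\le\varepsilon\,e(0,k,s)\}$. In the $\Theta$-statement the implied constants depend only on $s$, and the two-sided bound holds for all sufficiently small $\varepsilon$ (how small may depend on $s$ and $k$). *)

theory Defs
  imports "HOL-Analysis.Analysis" "HOL-Library.Landau_Symbols"
begin

text \<open>
  Functions on \<open>[0,1]\<close> are represented by total functions \<open>real \<Rightarrow> complex\<close>; every notion below
  depends only on the restriction to \<open>{0..1}\<close>.
\<close>

text \<open>
  The derivative is taken within \<open>[0,1]\<close>, hence it is one-sided at the endpoints. At points where
  the derivative does not exist the value is arbitrary; membership in the Sobolev space below
  makes this irrelevant.
\<close>

fun ivl_deriv :: "nat \<Rightarrow> (real \<Rightarrow> complex) \<Rightarrow> real \<Rightarrow> complex" where
  "ivl_deriv 0 f = f"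
| "ivl_deriv (Suc l) f = (\<lambda>x. vector_derivative (ivl_deriv l f) (at x within {0..1}))"

text \<open>
  The usual \<open>\<epsilon>\<close>-\<open>\<delta>\<close> definition for functions. The constant
  \<^const>\<open>absolutely_continuous\<close> of the library concerns measures. A division consists of finitely
  many nonempty compact intervals with pairwise disjoint interiors.
\<close>

definition abs_cont_on :: "real set \<Rightarrow> (real \<Rightarrow> complex) \<Rightarrow> bool" where
  "abs_cont_on S f \<longleftrightarrow>
     (\<forall>\<epsilon>>0. \<exists>\<delta>>0. \<forall>d. d division_of \<Union>d \<and> \<Union>d \<subseteq> S \<and> (\<Sum>K\<in>d. measure lborel K) < \<delta> \<longrightarrow>
        (\<Sum>K\<in>d. cmod (f (Sup K) - f (Inf K))) < \<epsilon>)"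

definition square_integrable_on :: "(real \<Rightarrow> complex) \<Rightarrow> real set \<Rightarrow> bool" where
  "square_integrable_on f S \<longleftrightarrow>
     f \<in> borel_measurable (lebesgue_on S) \<and> integrable (lebesgue_on S) (\<lambda>x. (cmod (f x))\<^sup>2)"

text \<open>
  The clause on almost everywhere differentiability is implied by absolute continuity (Lebesgue);
  it makes explicit that \<open>ivl_deriv s f\<close> is the almost everywhere derivative.
\<close>

definition sobolev :: "nat \<Rightarrow> (real \<Rightarrow> complex) set" where
  "sobolev s = {f.
     (\<forall>l < s - 1. \<forall>x\<in>{0..1}. ivl_deriv l f differentiable (at x within {0..1})) \<and>
     abs_cont_on {0..1} (ivl_deriv (s - 1) f) \<and>
     (AE x in lebesgue_on {0..1}. ivl_deriv (s - 1) f differentiable (at x within {0..1})) \<and>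
     square_integrable_on (ivl_deriv s f) {0..1}}"

definition periodic_sobolev :: "nat \<Rightarrow> (real \<Rightarrow> complex) set" where
  "periodic_sobolev s = {f \<in> sobolev s. \<forall>l<s. ivl_deriv l f 0 = ivl_deriv l f 1}"

definition sobolev_inner :: "nat \<Rightarrow> (real \<Rightarrow> complex) \<Rightarrow> (real \<Rightarrow> complex) \<Rightarrow> complex" where
  "sobolev_inner s f g =
     (\<Sum>l<s. (LINT x|lebesgue_on {0..1}. ivl_deriv l f x) *
             (LINT x|lebesgue_on {0..1}. cnj (ivl_deriv l g x))) +
     (LINT x|lebesgue_on {0..1}. ivl_deriv s f x * cnj (ivl_deriv s g x))"

definition sobolev_norm :: "nat \<Rightarrow> (real \<Rightarrow> complex) \<Rightarrow> real" where
  "sobolev_norm s f = sqrt (Re (sobolev_inner s f f))"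

definition osc_integral :: "int \<Rightarrow> (real \<Rightarrow> complex) \<Rightarrow> complex" where
  "osc_integral k f =
     (LINT x|lebesgue_on {0..1}. f x * exp (- 2 * of_real pi * \<i> * of_int k * of_real x))"

definition algorithms :: "nat \<Rightarrow> nat \<Rightarrow> ((real \<Rightarrow> complex) \<Rightarrow> complex) set" where
  "algorithms n s =
     {(\<lambda>f. \<Sum>j<n. a j * ivl_deriv (l j) f (x j)) |a l x. \<forall>j<n. l j < s \<and> x j \<in> {0..1}}"

text \<open>
  The error is extended-real valued, so that suprema and infima need no boundedness conditions.
\<close>

definition min_error ::
    "(real \<Rightarrow> complex) set \<Rightarrow> nat \<Rightarrow> int \<Rightarrow> nat \<Rightarrow> ereal" where
  "min_error F n k s =
     (INF A\<in>algorithms n s. SUP f\<in>{f\<in>F. sobolev_norm s f \<le> 1}.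
        ereal (cmod (osc_integral k f - A f)))"

definition error_sobolev :: "nat \<Rightarrow> int \<Rightarrow> nat \<Rightarrow> ereal" where
  "error_sobolev n k s = min_error (sobolev s) n k s"

definition error_periodic :: "nat \<Rightarrow> int \<Rightarrow> nat \<Rightarrow> ereal" where
  "error_periodic n k s = min_error (periodic_sobolev s) n k s"

definition n_nor :: "real \<Rightarrow> int \<Rightarrow> nat \<Rightarrow> nat" where
  "n_nor \<epsilon> k s = (LEAST n. error_sobolev n k s \<le> ereal \<epsilon> * error_sobolev 0 k s)"

abbreviation abs_at_top :: "int filter" where
  "abs_at_top \<equiv> filtercomap (\<lambda>k. \<bar>k\<bar>) at_top"

end

theory Submission
  imports Defs
begin

text \<open>
  The normalized criterion compares the error of \<open>n\<close> values with the initial error, which has the exact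
  order \<open>1 / |k|\<close> for every smoothness. One integration by parts gives the upper bound
  (\<open>initial_error_le\<close>), and the function \<open>x / 2\<close>, which is not periodic, gives the lower bound
  (\<open>initial_error_ge\<close>). Multiplying the tolerance by \<open>1 / |k|\<close> turns the theorem into
  statements about absolute errors.

  Two algorithms suffice for the upper bounds. Replacing the function on each of \<open>m\<close> equal
  subintervals by its Taylor polynomial at the left end point uses \<open>m * s\<close> values and has error at most
  \<open>m ^ (-s)\<close> for all frequencies (\<open>error_sobolev_taylor_le\<close>). Solving \<open>m ^ (-s) = \<epsilon> / |k|\<close>, up to
  constants, yields the upper bound in (a). Integrating by parts \<open>s\<close> times expresses the integral
  by \<open>2 * s\<close> boundary values up to an error of \<open>(2 * pi * |k|) ^ (-s)\<close>
  (\<open>error_sobolev_endpoints_le\<close>), which for \<open>s \<ge> 2\<close> is eventually far below \<open>\<epsilon> / |k|\<close>; this is (c).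

  For the lower bounds, periodic functions form a subclass, so the assumed bound
  \<open>c / (n + |k|) ^ s\<close> holds for the full class as well (\<open>error_periodic_le_error_sobolev\<close>). Comparing it with
  \<open>\<epsilon>\<close> times the initial error gives the lower bound in (a). For \<open>s = 1\<close> both sides are of order
  \<open>1 / |k|\<close>, so (b) depends on constants; the threshold comes from bounding the initial error by
  \<open>1 / (sqrt 2 * pi * |k|)\<close> (\<open>initial_error_le_smoothness_1\<close>).

  The analysis rests on the fundamental theorem of calculus for absolutely continuous functions, from
  which integration by parts at the top order of smoothness follows.
\<close>

section \<open>Calculus of absolutely continuous functions\<close>

lemma abs_cont_on_subset:
  assumes "abs_cont_on S f" "T \<subseteq> S"
  shows "abs_cont_on T f"
  using assms unfolding abs_cont_on_def by (meson order_trans)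

lemma abs_cont_onD:
  assumes "abs_cont_on S f" "0 < e"
  shows "\<exists>d>0. \<forall>p. p division_of \<Union>p \<and> \<Union>p \<subseteq> S \<and> (\<Sum>K\<in>p. measure lborel K) < d \<longrightarrow>
       (\<Sum>K\<in>p. cmod (f (Sup K) - f (Inf K))) < e"
  using assms by (simp add: abs_cont_on_def)

lemma division_of_realE:
  fixes p :: "real set set"
  assumes "p division_of T" "T \<subseteq> S" "K \<in> p"
  obtains u v where "K = {u..v}" "u \<le> v" "{u..v} \<subseteq> S"
proof -
  obtain u v where K: "K = {u..v}"
    using division_ofD(4)[OF assms(1,3)] by (auto simp: box_real)
  then show ?thesis
    using that[OF K] division_ofD(2,3)[OF assms(1,3)] assms(2) by auto
qed

lemma abs_cont_on_imp_continuous_on: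
  assumes "abs_cont_on {a..b} f"
  shows "continuous_on {a..b} f"
  unfolding continuous_on_iff
proof (intro ballI allI impI)
  fix x e :: real
  assume x: "x \<in> {a..b}" and e: "0 < e"
  obtain d where d: "0 < d"
    and f: "\<And>p. \<lbrakk>p division_of \<Union>p; \<Union>p \<subseteq> {a..b}; (\<Sum>K\<in>p. measure lborel K) < d\<rbrakk>
       \<Longrightarrow> (\<Sum>K\<in>p. cmod (f (Sup K) - f (Inf K))) < e"
    using abs_cont_onD[OF assms e] by blast
  have *: "dist (f v) (f u) < e" if "u \<le> v" "u \<in> {a..b}" "v \<in> {a..b}" "v - u < d" for u v
    using f[of "{{u..v}}"] that division_of_self[of u v] by (auto simp: dist_norm)
  show "\<exists>d>0. \<forall>x'\<in>{a..b}. dist x' x < d \<longrightarrow> dist (f x') (f x) < e"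
  proof (intro exI conjI ballI impI)
    fix y assume "y \<in> {a..b}" "dist y x < d"
    then show "dist (f y) (f x) < e"
      using *[of x y] *[of y x] x by (cases "x \<le> y") (auto simp: dist_real_def dist_commute)
  qed (rule d)
qed

lemma negligible_outer_open_real:
  fixes N :: "real set"
  assumes "negligible N" "0 < e"
  obtains T where "open T" "N \<subseteq> T" "T \<in> lmeasurable" "measure lebesgue T < e"
proof -
  have N: "N \<in> null_sets lebesgue" using assms(1) negligible_iff_null_sets by blast
  obtain T where T: "open T" "N \<subseteq> T" "T - N \<in> lmeasurable" "emeasure lebesgue (T - N) < ennreal e"
    using sets_lebesgue_outer_open[of N e] N assms(2) by blast
  have TN: "T = (T - N) \<union> N" using T(2) by blast
  have "T \<in> lmeasurable"
    using T(3) N by (subst TN) (intro fmeasurable.Un, auto intro: negligible_imp_measurable assms)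
  moreover have "measure lebesgue T = measure lebesgue (T - N)"
    by (rule sym, rule measure_Diff_null_set) (use N calculation in \<open>auto simp: fmeasurableD\<close>)
  moreover have "measure lebesgue (T - N) < e"
    using T(3,4) assms(2) by (simp add: emeasure_eq_measure2 ennreal_less_iff)
  ultimately show ?thesis using that[OF T(1,2)] by auto
qed

text \<open>
  The Riemann sums of the gauge integral are split by their tags. At tags outside the null set the
  increments of \<open>f\<close> are close to \<open>f'\<close> times the length, by differentiability. At tags inside the null
  set the gauge keeps the intervals in an open set of small measure, where absolute continuity
  makes the increments small, and there the derivative may be replaced by \<open>0\<close>.
\<close>

theorem fundamental_theorem_of_calculus_abs_cont:
  fixes f f' :: "real \<Rightarrow> complex"
  assumes ab: "a \<le> b" and ac: "abs_cont_on {a..b} f" and N: "negligible N"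
    and f': "\<And>x. x \<in> {a..b} - N \<Longrightarrow> (f has_vector_derivative f' x) (at x within {a..b})"
  shows "(f' has_integral (f b - f a)) {a..b}"
proof -
  define g where "g x = (if x \<in> N then 0 else f' x)" for x
  have "(g has_integral (f b - f a)) {a..b}"
    unfolding has_integral_real
  proof (intro allI impI)
    fix e :: real assume e: "e > 0"
    \<comment> \<open>The summand \<open>1\<close> keeps the quotient meaningful when \<open>a = b\<close>.\<close>
    define e' where "e' = e / (2 * (b - a + 1))"
    have e': "e' > 0" "e' * (b - a) < e / 2" using e ab by (auto simp: e'_def field_simps)
    have "\<forall>x. \<exists>d>0. x \<in> {a..b} - N \<longrightarrow>
         (\<forall>y\<in>{a..b}. norm (y-x) < d \<longrightarrow> norm (f y - f x - (y-x) *\<^sub>R f' x) \<le> e' * norm (y-x))"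
      using f'[unfolded has_vector_derivative_def has_derivative_within_alt] e' by blast
    then obtain d where d: "\<And>x. 0 < d x"
        "\<And>x y. \<lbrakk>x \<in> {a..b} - N; y \<in> {a..b}; norm (y-x) < d x\<rbrakk>
           \<Longrightarrow> norm (f y - f x - (y-x) *\<^sub>R f' x) \<le> e' * norm (y-x)"
      by metis
    obtain r where r: "0 < r"
      and fr: "\<And>p. \<lbrakk>p division_of \<Union>p; \<Union>p \<subseteq> {a..b}; (\<Sum>K\<in>p. measure lborel K) < r\<rbrakk>
         \<Longrightarrow> (\<Sum>K\<in>p. cmod (f (Sup K) - f (Inf K))) < e / 2"
      using abs_cont_onD[OF ac half_gt_zero[OF e]] by blast
    obtain T where T: "open T" "N \<subseteq> T" "T \<in> lmeasurable" "measure lebesgue T < r"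
      using negligible_outer_open_real[OF N r] by blast
    \<comment> \<open>Tags in the null set may only see intervals inside the small open set \<open>T\<close>.\<close>
    define \<gamma> where "\<gamma> x = (if x \<in> N then T else ball x (d x))" for x
    have g\<gamma>: "gauge \<gamma>"
      using T d(1) by (auto simp: gauge_def \<gamma>_def)
    show "\<exists>\<gamma>. gauge \<gamma> \<and> (\<forall>\<D>. \<D> tagged_division_of {a..b} \<and> \<gamma> fine \<D> \<longrightarrow>
             norm ((\<Sum>(x, k)\<in>\<D>. measure lborel k *\<^sub>R g x) - (f b - f a)) < e)"
    proof (intro exI[of _ \<gamma>] conjI g\<gamma> allI impI)
      fix p assume "p tagged_division_of {a..b} \<and> \<gamma> fine p"
      then have p: "p tagged_division_of {a..b}" and fine: "\<gamma> fine p" by auto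
      note pD = tagged_division_ofD[OF p]
      have fin: "finite p" by (rule pD(1))
      have K: "\<exists>u v. K = {u..v} \<and> u \<le> v \<and> x \<in> {u..v} \<and> {u..v} \<subseteq> {a..b}" if "(x,K) \<in> p" for x K
        using pD(2-4)[OF that] by (force simp: box_real)
      let ?D = "\<lambda>(x,K). measure lborel K *\<^sub>R g x - (f (Sup K) - f (Inf K))"
      define pN where "pN = {xK \<in> p. fst xK \<in> N}"
      have split: "p = pN \<union> (p - pN)" and disj: "pN \<inter> (p - pN) = {}" and sub: "pN \<subseteq> p"
        by (auto simp: pN_def)
      have finN: "finite pN" using fin sub finite_subset by blast
      have ba: "b - a = (\<Sum>(x,K)\<in>p. Sup K - Inf K)"
        and fba: "f b - f a = (\<Sum>(x,K)\<in>p. f(Sup K) - f(Inf K))"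
        using additive_tagged_division_1[OF ab p, of "\<lambda>x. x"] additive_tagged_division_1[OF ab p, of f]
        by auto
      have eq: "(\<Sum>(x, k)\<in>p. measure lborel k *\<^sub>R g x) - (f b - f a) = sum ?D p"
        unfolding fba by (simp add: sum_subtractf case_prod_unfold)
      have good: "norm (?D xK) \<le> e' * (case xK of (x,K) \<Rightarrow> Sup K - Inf K)" if xK: "xK \<in> p - pN" for xK
      proof -
        obtain x K where xKeq: "xK = (x,K)" by force
        have xp: "(x,K) \<in> p" and xN: "x \<notin> N" using xK xKeq by (auto simp: pN_def)
        obtain u v where uv: "K = {u..v}" "u \<le> v" "x \<in> {u..v}" "{u..v} \<subseteq> {a..b}"
          using K[OF xp] by blast
        have uvab: "u \<in> {a..b}" "v \<in> {a..b}" "x \<in> {a..b}" using uv by auto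
        have uvK: "u \<in> K" "v \<in> K" using uv by auto
        have "K \<subseteq> ball x (d x)" using fineD[OF fine xp] xN by (simp add: \<gamma>_def)
        then have "u \<in> ball x (d x)" "v \<in> ball x (d x)"
          using uvK by blast+
        then have "norm (u - x) < d x" "norm (v - x) < d x"
          by (auto simp: dist_real_def)
        then have 1: "norm (f u - f x - (u-x) *\<^sub>R f' x) \<le> e' * norm (u-x)"
             "norm (f v - f x - (v-x) *\<^sub>R f' x) \<le> e' * norm (v-x)"
          using d(2)[of x u] d(2)[of x v] uvab xN by auto
        have "norm ((v - u) *\<^sub>R f' x - (f v - f u))
            = norm (f u - f x - (u - x) *\<^sub>R f' x - (f v - f x - (v - x) *\<^sub>R f' x))"
          by (auto simp: algebra_simps)
        also have "\<dots> \<le> e' * norm (u-x) + e' * norm (v-x)"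
          using 1 norm_triangle_ineq4 add_mono order_trans by blast
        also have "\<dots> = e' * (v - u)" using uv by (auto simp: algebra_simps)
        finally show ?thesis using uv xN xKeq by (simp add: g_def)
      qed
      have "norm (sum ?D (p - pN)) \<le> (\<Sum>xK\<in>p - pN. e' * (case xK of (x,K) \<Rightarrow> Sup K - Inf K))"
        by (rule sum_norm_le) (rule good)
      also have "\<dots> \<le> (\<Sum>xK\<in>p. e' * (case xK of (x,K) \<Rightarrow> Sup K - Inf K))"
      proof (rule sum_mono2[OF fin])
        fix xK assume "xK \<in> p - (p - pN)"
        then obtain x L where "xK = (x,L)" "(x,L) \<in> p" by (cases xK) auto
        then show "0 \<le> e' * (case xK of (x,K) \<Rightarrow> Sup K - Inf K)"
          using K[of x L] e' by auto
      qed auto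
      also have "\<dots> = e' * (b - a)" unfolding ba by (simp add: sum_distrib_left)
      also have "\<dots> < e / 2" by (rule e')
      finally have big: "norm (sum ?D (p - pN)) < e / 2" .
      \<comment> \<open>The intervals tagged in the null set are essentially disjoint and lie in \<open>T\<close>, so their
          total length is below the threshold of absolute continuity.\<close>
      have "pN tagged_partial_division_of {a..b}"
        using tagged_partial_division_subset[OF _ sub] p tagged_division_of_def by blast
      then have pN: "pN tagged_division_of \<Union>(snd ` pN)"
        by (rule tagged_partial_division_of_Union_self)
      define q where "q = snd ` pN"
      have q: "q division_of \<Union>q"
        unfolding q_def by (rule division_of_tagged_division[OF pN])
      have qsub: "\<Union>q \<subseteq> {a..b}" using pD(3) sub by (force simp: q_def)
      have qT: "\<Union>q \<subseteq> T" using fineD[OF fine] by (force simp: q_def \<gamma>_def pN_def)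
      have "(\<Sum>K\<in>q. measure lborel K) = (\<Sum>K\<in>q. measure lebesgue K)"
        by (intro sum.cong) (auto elim!: division_of_realE[OF q qsub])
      also have "\<dots> = measure lebesgue (\<Union>q)"
        by (rule content_division[OF q])
      also have "\<dots> \<le> measure lebesgue T"
        by (rule measure_mono_fmeasurable[OF qT]) (use T(3) lmeasurable_division[OF q] in auto)
      finally have "(\<Sum>K\<in>q. measure lborel K) < r" using T(4) by linarith
      then have sm: "(\<Sum>K\<in>q. cmod (f (Sup K) - f (Inf K))) < e / 2"
        using fr[OF q qsub] by blast
      \<comment> \<open>Degenerate intervals may be tagged twice, and contribute nothing; the empty box is
          excluded because its bounds are arbitrary.\<close>
      define h where "h K = (if K = {} then 0 else cmod (f (Sup K) - f (Inf K)))" for K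
      have ne: "K \<noteq> {}" if "K \<in> q" for K
        using division_ofD(3)[OF q that] .
      have "norm (sum ?D pN) \<le> (\<Sum>(x,K)\<in>pN. h K)"
      proof (rule sum_norm_le)
        fix xK assume xK: "xK \<in> pN"
        then have "snd xK \<noteq> {}" "fst xK \<in> N"
          by (auto intro!: ne simp: q_def pN_def)
        then show "norm (?D xK) \<le> (case xK of (x,K) \<Rightarrow> h K)"
          by (cases xK) (auto simp: g_def h_def norm_minus_commute)
      qed
      also have "\<dots> = (\<Sum>K\<in>q. h K)"
      proof (subst sum.over_tagged_division_lemma[OF pN])
        fix u v :: real assume "box u v = {}"
        then show "h (cbox u v) = 0"
          by (cases "u = v") (auto simp: h_def box_eq_empty)
      qed (simp add: q_def)
      also have "\<dots> = (\<Sum>K\<in>q. cmod (f (Sup K) - f (Inf K)))"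
        by (intro sum.cong) (auto simp: h_def dest: ne)
      finally have small: "norm (sum ?D pN) < e / 2" using sm by linarith
      have tot: "sum ?D p = sum ?D pN + sum ?D (p - pN)"
        using sum.union_disjoint[OF finN _ disj, of ?D] fin split by auto
      then show "norm ((\<Sum>(x, k)\<in>p. measure lborel k *\<^sub>R g x) - (f b - f a)) < e"
        unfolding eq tot using big small norm_triangle_ineq[of "sum ?D pN" "sum ?D (p - pN)"] by linarith
    qed
  qed
  then show ?thesis
    by (rule has_integral_spike[OF N, rotated]) (auto simp: g_def)
qed

lemma lipschitz_imp_abs_cont_on:
  fixes f :: "real \<Rightarrow> complex"
  assumes "\<And>x y. \<lbrakk>x \<in> S; y \<in> S; x \<le> y\<rbrakk> \<Longrightarrow> cmod (f y - f x) \<le> L * (y - x)"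
  shows "abs_cont_on S f"
  unfolding abs_cont_on_def
proof (intro allI impI)
  fix e :: real assume e: "e > 0"
  define L' where "L' = max L 1"
  show "\<exists>\<delta>>0. \<forall>d. d division_of \<Union> d \<and> \<Union> d \<subseteq> S \<and> (\<Sum>K\<in>d. measure lborel K) < \<delta> \<longrightarrow>
          (\<Sum>K\<in>d. cmod (f (Sup K) - f (Inf K))) < e"
  proof (intro exI[of _ "e / L'"] conjI allI impI)
    fix p assume "p division_of \<Union> p \<and> \<Union> p \<subseteq> S \<and> (\<Sum>K\<in>p. measure lborel K) < e / L'"
    then have p: "p division_of \<Union> p" "\<Union> p \<subseteq> S" "(\<Sum>K\<in>p. measure lborel K) < e / L'" by auto
    have "(\<Sum>K\<in>p. cmod (f (Sup K) - f (Inf K))) \<le> (\<Sum>K\<in>p. L' * measure lborel K)"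
    proof (rule sum_mono)
      fix K assume "K \<in> p"
      then obtain u v where K: "K = {u..v}" "u \<le> v" "{u..v} \<subseteq> S"
        using division_of_realE[OF p(1,2)] by blast
      have "cmod (f v - f u) \<le> L * (v - u)" by (rule assms) (use K in auto)
      also have "\<dots> \<le> L' * (v - u)" using K by (intro mult_right_mono) (auto simp: L'_def)
      finally show "cmod (f (Sup K) - f (Inf K)) \<le> L' * measure lborel K" using K by simp
    qed
    also have "\<dots> < e" using p(3) by (simp add: sum_distrib_left[symmetric] L'_def field_simps)
    finally show "(\<Sum>K\<in>p. cmod (f (Sup K) - f (Inf K))) < e" .
  qed (use e in \<open>auto simp: L'_def\<close>)
qed

lemma abs_cont_on_mult:
  fixes f g :: "real \<Rightarrow> complex"
  assumes f: "abs_cont_on {a..b} f" and g: "abs_cont_on {a..b} g"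
  shows "abs_cont_on {a..b} (\<lambda>x. f x * g x)"
  unfolding abs_cont_on_def
proof (intro allI impI)
  fix e :: real assume e: "e > 0"
  have "\<exists>B>0. \<forall>x\<in>{a..b}. cmod (h x) \<le> B" if "abs_cont_on {a..b} h" for h
  proof -
    have "bounded (h ` {a..b})"
      by (intro compact_imp_bounded compact_continuous_image abs_cont_on_imp_continuous_on that compact_Icc)
    then show ?thesis unfolding bounded_pos by blast
  qed
  from this[OF f] this[OF g]
  obtain A B where A: "A > 0" "\<And>x. x \<in> {a..b} \<Longrightarrow> cmod (f x) \<le> A"
    and B: "B > 0" "\<And>x. x \<in> {a..b} \<Longrightarrow> cmod (g x) \<le> B"
    by blast
  have eB: "0 < e / (2 * B)" and eA: "0 < e / (2 * A)" using e A B by auto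
  obtain d1 where d1: "0 < d1"
    "\<And>p. \<lbrakk>p division_of \<Union>p; \<Union>p \<subseteq> {a..b}; (\<Sum>K\<in>p. measure lborel K) < d1\<rbrakk>
       \<Longrightarrow> (\<Sum>K\<in>p. cmod (f (Sup K) - f (Inf K))) < e / (2 * B)"
    using abs_cont_onD[OF f eB] by blast
  obtain d2 where d2: "0 < d2"
    "\<And>p. \<lbrakk>p division_of \<Union>p; \<Union>p \<subseteq> {a..b}; (\<Sum>K\<in>p. measure lborel K) < d2\<rbrakk>
       \<Longrightarrow> (\<Sum>K\<in>p. cmod (g (Sup K) - g (Inf K))) < e / (2 * A)"
    using abs_cont_onD[OF g eA] by blast
  show "\<exists>\<delta>>0. \<forall>d. d division_of \<Union> d \<and> \<Union> d \<subseteq> {a..b} \<and> (\<Sum>K\<in>d. measure lborel K) < \<delta> \<longrightarrow>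
          (\<Sum>K\<in>d. cmod (f (Sup K) * g (Sup K) - f (Inf K) * g (Inf K))) < e"
  proof (intro exI[of _ "min d1 d2"] conjI allI impI)
    fix p assume "p division_of \<Union> p \<and> \<Union> p \<subseteq> {a..b} \<and> (\<Sum>K\<in>p. measure lborel K) < min d1 d2"
    then have p: "p division_of \<Union> p" "\<Union> p \<subseteq> {a..b}" "(\<Sum>K\<in>p. measure lborel K) < d1"
      "(\<Sum>K\<in>p. measure lborel K) < d2" by auto
    let ?F = "\<lambda>K. cmod (f (Sup K) - f (Inf K))" and ?G = "\<lambda>K. cmod (g (Sup K) - g (Inf K))"
    have "(\<Sum>K\<in>p. cmod (f (Sup K) * g (Sup K) - f (Inf K) * g (Inf K)))
        \<le> (\<Sum>K\<in>p. ?F K * B + A * ?G K)"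
    proof (rule sum_mono)
      fix K assume "K \<in> p"
      then obtain u v where K: "K = {u..v}" "u \<le> v" "{u..v} \<subseteq> {a..b}"
        using division_of_realE[OF p(1,2)] by blast
      have "f v * g v - f u * g u = (f v - f u) * g v + f u * (g v - g u)"
        by (simp add: algebra_simps)
      then have "cmod (f v * g v - f u * g u) \<le> cmod (f v - f u) * cmod (g v) + cmod (f u) * cmod (g v - g u)"
        by (metis norm_triangle_ineq norm_mult)
      also have "\<dots> \<le> cmod (f v - f u) * B + A * cmod (g v - g u)"
        using K A(2) B(2) by (intro add_mono mult_left_mono mult_right_mono) auto
      finally show "cmod (f (Sup K) * g (Sup K) - f (Inf K) * g (Inf K)) \<le> ?F K * B + A * ?G K"
        using K by simp
    qed
    also have "\<dots> = sum ?F p * B + A * sum ?G p"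
      by (simp add: sum.distrib sum_distrib_left sum_distrib_right)
    also have "\<dots> < e / (2 * B) * B + A * (e / (2 * A))"
      using d1(2)[OF p(1-3)] d2(2)[OF p(1,2,4)] A B
      by (intro add_strict_mono mult_strict_left_mono mult_strict_right_mono)
    also have "\<dots> = e" using A B by simp
    finally show "(\<Sum>K\<in>p. cmod (f (Sup K) * g (Sup K) - f (Inf K) * g (Inf K))) < e" .
  qed (use d1 d2 in auto)
qed

lemma continuous_deriv_imp_abs_cont_on:
  fixes f :: "real \<Rightarrow> complex"
  assumes "\<And>x. x \<in> {a..b} \<Longrightarrow> (f has_vector_derivative f' x) (at x within {a..b})"
    and "continuous_on {a..b} f'"
  shows "abs_cont_on {a..b} f"
proof -
  have "bounded (f' ` {a..b})"
    by (intro compact_imp_bounded compact_continuous_image assms(2) compact_Icc)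
  then obtain B where B: "\<And>x. x \<in> {a..b} \<Longrightarrow> cmod (f' x) \<le> B"
    unfolding bounded_iff by blast
  show ?thesis
  proof (rule lipschitz_imp_abs_cont_on[where L = B])
    fix x y assume xy: "x \<in> {a..b}" "y \<in> {a..b}" "x \<le> y"
    have "(f' has_integral f y - f x) {x..y}"
      using xy by (intro fundamental_theorem_of_calculus)
        (auto intro: has_vector_derivative_within_subset[OF assms(1)])
    moreover have "0 \<le> B" using norm_ge_zero order_trans B xy(1) by blast
    ultimately show "cmod (f y - f x) \<le> B * (y - x)"
      using has_integral_bound_real[of B "{}" f' "f y - f x" x y] B xy by auto
  qed
qed

text \<open>
  Integration by parts reduces to the fundamental theorem, because the product with a continuously
  differentiable weight is again absolutely continuous.
\<close>

lemma abs_cont_by_parts: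
  fixes u v w w' :: "real \<Rightarrow> complex"
  assumes ab: "a \<le> b" and u: "abs_cont_on {a..b} u" and N: "negligible N"
    and v: "\<And>x. x \<in> {a..b} - N \<Longrightarrow> (u has_vector_derivative v x) (at x within {a..b})"
    and w: "\<And>x. x \<in> {a..b} \<Longrightarrow> (w has_vector_derivative w' x) (at x within {a..b})"
    and w': "continuous_on {a..b} w'"
  shows "((\<lambda>x. u x * w' x + v x * w x) has_integral (u b * w b - u a * w a)) {a..b}"
proof (rule fundamental_theorem_of_calculus_abs_cont[OF ab _ N])
  show "abs_cont_on {a..b} (\<lambda>x. u x * w x)"
    by (intro abs_cont_on_mult u continuous_deriv_imp_abs_cont_on[OF w w'])
  show "((\<lambda>x. u x * w x) has_vector_derivative u x * w' x + v x * w x) (at x within {a..b})"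
    if "x \<in> {a..b} - N" for x
    using has_vector_derivative_mult[OF v w] that by auto
qed

section \<open>Sobolev functions\<close>

text \<open>
  Higher derivatives stay folded: they enter the estimates only through the relation between
  consecutive orders, and unfolding would expose the choice-based \<^const>\<open>vector_derivative\<close>.
\<close>

declare ivl_deriv.simps(2) [simp del]

lemma sobolev_differentiable:
  assumes "f \<in> sobolev s" "l < s - 1" "x \<in> {0..1}"
  shows "(ivl_deriv l f has_vector_derivative ivl_deriv (Suc l) f x) (at x within {0..1})"
  using assms by (auto simp: sobolev_def vector_derivative_works ivl_deriv.simps(2))

lemma sobolev_continuous_on:
  assumes f: "f \<in> sobolev s" and l: "l < s"
  shows "continuous_on {0..1} (ivl_deriv l f)"
proof (cases "l = s - 1")
  case True
  then show ?thesis
    using f by (auto simp: sobolev_def intro: abs_cont_on_imp_continuous_on)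
next
  case False
  then have "l < s - 1" using l by simp
  from sobolev_differentiable[OF f this] show ?thesis
    using has_vector_derivative_continuous continuous_on_eq_continuous_within by blast
qed

text \<open>
  The derivative of order \<open>s - 1\<close> is absolutely continuous by definition; the lower ones have a continuous,
  hence bounded, derivative. So one rule for integration by parts covers every order below \<open>s\<close>.
\<close>

lemma sobolev_abs_cont_on:
  assumes f: "f \<in> sobolev s" and l: "l < s"
  shows "abs_cont_on {0..1} (ivl_deriv l f)"
proof (cases "l = s - 1")
  case True
  then show ?thesis using f by (auto simp: sobolev_def)
next
  case False
  then have "l < s - 1" "Suc l < s" using l by auto
  then show ?thesis
    by (intro continuous_deriv_imp_abs_cont_on[where f' = "ivl_deriv (Suc l) f"]
        sobolev_differentiable[OF f] sobolev_continuous_on[OF f])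
qed

lemma sobolev_ae_derivative:
  assumes f: "f \<in> sobolev s" and l: "l < s"
  obtains N where "negligible N"
    "\<And>x. x \<in> {0..1} - N \<Longrightarrow>
       (ivl_deriv l f has_vector_derivative ivl_deriv (Suc l) f x) (at x within {0..1})"
proof (cases "l = s - 1")
  case True
  with f have "AE x in lebesgue_on {0..1}. ivl_deriv l f differentiable (at x within {0..1})"
    by (auto simp: sobolev_def)
  then have "AE x in lebesgue. x \<in> {0..1} \<longrightarrow> ivl_deriv l f differentiable (at x within {0..1})"
    by (subst (asm) AE_restrict_space_iff) auto
  then obtain N where N: "N \<in> null_sets lebesgue"
    "\<And>x. x \<notin> N \<Longrightarrow> x \<in> {0..1} \<Longrightarrow> ivl_deriv l f differentiable (at x within {0..1})"
    by (auto simp: eventually_ae_filter)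
  show ?thesis
    by (rule that[of N]) (use N in \<open>auto simp: vector_derivative_works negligible_iff_null_sets ivl_deriv.simps(2)\<close>)
next
  case False
  then show ?thesis
    using sobolev_differentiable[OF f] l by (intro that[of "{}"]) auto
qed

lemma sobolev_by_parts:
  assumes f: "f \<in> sobolev s" and l: "l < s" and ab: "0 \<le> a" "a \<le> b" "b \<le> 1"
    and w: "\<And>x. x \<in> {a..b} \<Longrightarrow> (w has_vector_derivative w' x) (at x within {a..b})"
    and w': "continuous_on {a..b} w'"
  shows "((\<lambda>x. ivl_deriv l f x * w' x + ivl_deriv (Suc l) f x * w x) has_integral
           (ivl_deriv l f b * w b - ivl_deriv l f a * w a)) {a..b}"
proof -
  have sub: "{a..b} \<subseteq> {0..1}" using ab by auto
  obtain N where N: "negligible N"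
    "\<And>x. x \<in> {0..1} - N \<Longrightarrow>
       (ivl_deriv l f has_vector_derivative ivl_deriv (Suc l) f x) (at x within {0..1})"
    using sobolev_ae_derivative[OF f l] by blast
  show ?thesis
    by (rule abs_cont_by_parts[OF ab(2) abs_cont_on_subset[OF sobolev_abs_cont_on[OF f l] sub] N(1) _ w w'])
      (use N(2) sub in \<open>auto intro: has_vector_derivative_within_subset[OF _ sub]\<close>)
qed

lemma sobolev_ftc:
  assumes "f \<in> sobolev s" "l < s" "0 \<le> a" "a \<le> b" "b \<le> 1"
  shows "(ivl_deriv (Suc l) f has_integral (ivl_deriv l f b - ivl_deriv l f a)) {a..b}"
  using sobolev_by_parts[OF assms, of "\<lambda>_. 1" "\<lambda>_. 0"] by simp

lemma sobolev_top_square_integrable: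
  assumes "f \<in> sobolev s"
  shows "ivl_deriv s f \<in> borel_measurable (lebesgue_on {0..1})"
    and "(\<lambda>x. (cmod (ivl_deriv s f x))\<^sup>2) absolutely_integrable_on {0..1}"
proof -
  have *: "square_integrable_on (ivl_deriv s f) {0..1}" using assms by (simp add: sobolev_def)
  show "ivl_deriv s f \<in> borel_measurable (lebesgue_on {0..1})"
    using * by (simp add: square_integrable_on_def)
  have "integrable (lebesgue_on {0..1}) (\<lambda>x. (cmod (ivl_deriv s f x))\<^sup>2)"
    using * by (simp add: square_integrable_on_def)
  then show "(\<lambda>x. (cmod (ivl_deriv s f x))\<^sup>2) absolutely_integrable_on {0..1}"
    by (simp add: set_integrable_def integrable_restrict_space)
qed

lemma square_integrable_mult_continuous:
  fixes g h :: "real \<Rightarrow> complex"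
  assumes g: "g \<in> borel_measurable (lebesgue_on {0..1})"
    and g2: "(\<lambda>x. (cmod (g x))\<^sup>2) integrable_on {0..1}" and h: "continuous_on {0..1} h"
  shows "(\<lambda>x. g x * h x) absolutely_integrable_on {0..1}"
proof (rule measurable_bounded_by_integrable_imp_absolutely_integrable)
  have h': "(\<lambda>x. (cmod (h x))\<^sup>2) integrable_on {0..1}"
    by (intro integrable_continuous_real continuous_intros h)
  have "h \<in> borel_measurable (lebesgue_on {0..1})"
    by (intro continuous_imp_measurable_on_sets_lebesgue h) simp
  then show "(\<lambda>x. g x * h x) \<in> borel_measurable (lebesgue_on {0..1})"
    using g by measurable
  show "(\<lambda>x. ((cmod (g x))\<^sup>2 + (cmod (h x))\<^sup>2) / 2) integrable_on {0..1}"
    by (intro integrable_on_divide integrable_add g2 h')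
  show "norm (g x * h x) \<le> ((cmod (g x))\<^sup>2 + (cmod (h x))\<^sup>2) / 2" for x
    using sum_squares_bound[of "cmod (g x)" "cmod (h x)"] by (simp add: norm_mult)
qed simp

text \<open>
  Cauchy-Schwarz against the unit ball of \<open>L\<^sub>2\<close>, obtained by integrating the weighted
  inequality \<open>2 a b \<le> q a\<^sup>2 + b\<^sup>2 / q\<close>.
\<close>

lemma integral_norm_mult_le:
  fixes g h :: "real \<Rightarrow> complex"
  assumes g: "g \<in> borel_measurable (lebesgue_on {0..1})"
    and g2: "(\<lambda>x. (cmod (g x))\<^sup>2) integrable_on {0..1}" "integral {0..1} (\<lambda>x. (cmod (g x))\<^sup>2) \<le> 1"
    and h: "continuous_on {0..1} h" and q: "0 < q" "integral {0..1} (\<lambda>x. (cmod (h x))\<^sup>2) \<le> q\<^sup>2"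
  shows "integral {0..1} (\<lambda>x. cmod (g x * h x)) \<le> q"
proof -
  have h': "(\<lambda>x. (cmod (h x))\<^sup>2) integrable_on {0..1}"
    by (intro integrable_continuous_real continuous_intros h)
  have "integral {0..1} (\<lambda>x. cmod (g x * h x))
      \<le> integral {0..1} (\<lambda>x. q / 2 * (cmod (g x))\<^sup>2 + 1 / (2 * q) * (cmod (h x))\<^sup>2)"
  proof (rule integral_le)
    show "(\<lambda>x. cmod (g x * h x)) integrable_on {0..1}"
      using square_integrable_mult_continuous[OF g g2(1) h] by (simp add: absolutely_integrable_on_def)
    show "(\<lambda>x. q / 2 * (cmod (g x))\<^sup>2 + 1 / (2 * q) * (cmod (h x))\<^sup>2) integrable_on {0..1}"
      by (intro integrable_add integrable_on_mult_right g2 h')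
    fix x
    have "0 \<le> (q * cmod (g x) - cmod (h x))\<^sup>2" by simp
    then have "2 * q * (cmod (g x) * cmod (h x)) \<le> q\<^sup>2 * (cmod (g x))\<^sup>2 + (cmod (h x))\<^sup>2"
      by (simp add: power2_diff power_mult_distrib algebra_simps)
    then show "cmod (g x * h x) \<le> q / 2 * (cmod (g x))\<^sup>2 + 1 / (2 * q) * (cmod (h x))\<^sup>2"
      using q(1) by (simp add: norm_mult field_simps power2_eq_square)
  qed
  also have "\<dots> = q / 2 * integral {0..1} (\<lambda>x. (cmod (g x))\<^sup>2) + 1 / (2 * q) * integral {0..1} (\<lambda>x. (cmod (h x))\<^sup>2)"
    by (subst integral_add) (simp_all only: integral_mult_right integrable_on_mult_right g2 h')
  also have "\<dots> \<le> q / 2 * 1 + 1 / (2 * q) * q\<^sup>2"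
    using q g2(2) by (intro add_mono mult_left_mono) auto
  also have "\<dots> = q" using q(1) by (simp add: power2_eq_square)
  finally show ?thesis .
qed

lemma sobolev_absolutely_integrable:
  assumes f: "f \<in> sobolev s" and l: "l \<le> s"
  shows "ivl_deriv l f absolutely_integrable_on {0..1}"
proof (cases "l < s")
  case True
  then show ?thesis
    by (intro absolutely_integrable_continuous_real sobolev_continuous_on[OF f])
next
  case False
  then have "l = s" using l by simp
  then show ?thesis
    using square_integrable_mult_continuous[of "ivl_deriv s f" "\<lambda>_. 1"] sobolev_top_square_integrable[OF f]
    by (simp add: absolutely_integrable_on_def)
qed

lemma sobolev_inner_self:
  assumes f: "f \<in> sobolev s"
  shows "sobolev_inner s f f = of_real ((\<Sum>l<s. (cmod (integral {0..1} (ivl_deriv l f)))\<^sup>2)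
      + integral {0..1} (\<lambda>x. (cmod (ivl_deriv s f x))\<^sup>2))"
proof -
  have L: "(LINT x|lebesgue_on {0..1}. ivl_deriv l f x) = integral {0..1} (ivl_deriv l f)" if "l < s" for l
    using absolutely_integrable_imp_integrable[OF sobolev_absolutely_integrable[OF f]] that
    by (intro lebesgue_integral_eq_integral) auto
  have T: "(LINT x|lebesgue_on {0..1}. (cmod (ivl_deriv s f x))\<^sup>2)
      = integral {0..1} (\<lambda>x. (cmod (ivl_deriv s f x))\<^sup>2)"
    using absolutely_integrable_imp_integrable[OF sobolev_top_square_integrable(2)[OF f]]
    by (intro lebesgue_integral_eq_integral) auto
  show ?thesis
    unfolding sobolev_inner_def integral_cnj complex_norm_square[symmetric] integral_complex_of_real T
    by (simp add: L flip: complex_norm_square)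
qed

lemma sobolev_unit_ball:
  assumes f: "f \<in> sobolev s" and n: "sobolev_norm s f \<le> 1"
  shows "integral {0..1} (\<lambda>x. (cmod (ivl_deriv s f x))\<^sup>2) \<le> 1"
    and "l < s \<Longrightarrow> cmod (integral {0..1} (ivl_deriv l f)) \<le> 1"
proof -
  let ?S = "\<Sum>l<s. (cmod (integral {0..1} (ivl_deriv l f)))\<^sup>2"
  let ?T = "integral {0..1} (\<lambda>x. (cmod (ivl_deriv s f x))\<^sup>2)"
  have T: "0 \<le> ?T"
    using sobolev_top_square_integrable(2)[OF f] by (intro integral_nonneg) (auto simp: absolutely_integrable_on_def)
  have S: "0 \<le> ?S" by (intro sum_nonneg) auto
  have "sobolev_norm s f = sqrt (?S + ?T)"
    using sobolev_inner_self[OF f] by (simp add: sobolev_norm_def)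
  then have le: "?S + ?T \<le> 1" using n by simp
  with le S show "?T \<le> 1" by linarith
  show "cmod (integral {0..1} (ivl_deriv l f)) \<le> 1" if "l < s"
  proof -
    have "(cmod (integral {0..1} (ivl_deriv l f)))\<^sup>2 \<le> ?S"
      using that by (intro member_le_sum[where f = "\<lambda>l. (cmod (integral {0..1} (ivl_deriv l f)))\<^sup>2"]) auto
    then have "(cmod (integral {0..1} (ivl_deriv l f)))\<^sup>2 \<le> 1\<^sup>2" using le T by simp
    then show ?thesis by (rule power2_le_imp_le) simp
  qed
qed

lemma sobolev_top_mult_le:
  assumes f: "f \<in> sobolev s" and n: "sobolev_norm s f \<le> 1"
    and h: "continuous_on {0..1} h" and q: "0 < q" "integral {0..1} (\<lambda>x. (cmod (h x))\<^sup>2) \<le> q\<^sup>2"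
  shows "cmod (integral {0..1} (\<lambda>x. ivl_deriv s f x * h x)) \<le> q"
proof -
  have g2: "(\<lambda>x. (cmod (ivl_deriv s f x))\<^sup>2) integrable_on {0..1}"
    using sobolev_top_square_integrable(2)[OF f] by (auto simp: absolutely_integrable_on_def)
  note m = sobolev_top_square_integrable(1)[OF f]
  have "cmod (integral {0..1} (\<lambda>x. ivl_deriv s f x * h x)) \<le> integral {0..1} (\<lambda>x. cmod (ivl_deriv s f x * h x))"
    using square_integrable_mult_continuous[OF m g2 h]
    by (intro integral_norm_bound_integral) (auto simp: absolutely_integrable_on_def)
  also have "\<dots> \<le> q"
    by (rule integral_norm_mult_le[OF m g2 sobolev_unit_ball(1)[OF f n] h q])
  finally show ?thesis .
qed

lemma sobolev_top_L1_le:
  assumes f: "f \<in> sobolev s" and n: "sobolev_norm s f \<le> 1"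
  shows "integral {0..1} (\<lambda>x. cmod (ivl_deriv s f x)) \<le> 1"
  using integral_norm_mult_le[OF sobolev_top_square_integrable(1)[OF f] _ sobolev_unit_ball(1)[OF f n], of "\<lambda>_. 1" 1]
    sobolev_top_square_integrable(2)[OF f]
  by (auto simp: absolutely_integrable_on_def)

lemma sobolev_increment_le:
  assumes f: "f \<in> sobolev s" and l: "l < s" and ab: "0 \<le> a" "a \<le> x" "x \<le> b" "b \<le> 1"
  shows "cmod (ivl_deriv l f x - ivl_deriv l f a) \<le> integral {a..b} (\<lambda>t. cmod (ivl_deriv (Suc l) f t))"
proof -
  have ai: "ivl_deriv (Suc l) f absolutely_integrable_on {a..b}"
    using ab l by (intro absolutely_integrable_on_subinterval[OF sobolev_absolutely_integrable[OF f]]) auto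
  then have ax: "ivl_deriv (Suc l) f absolutely_integrable_on {a..x}"
    using ab by (intro absolutely_integrable_on_subinterval[OF ai]) auto
  have "cmod (ivl_deriv l f x - ivl_deriv l f a) = cmod (integral {a..x} (ivl_deriv (Suc l) f))"
    using sobolev_ftc[OF f l, of a x] ab by (simp add: integral_unique)
  also have "\<dots> \<le> integral {a..x} (\<lambda>t. cmod (ivl_deriv (Suc l) f t))"
    using ax by (intro integral_norm_bound_integral) (auto simp: absolutely_integrable_on_def)
  also have "\<dots> \<le> integral {a..b} (\<lambda>t. cmod (ivl_deriv (Suc l) f t))"
    using ax ai ab by (intro integral_subset_le) (auto simp: absolutely_integrable_on_def)
  finally show ?thesis .
qed

text \<open>
  A function differs from its mean by at most the \<open>L\<^sub>1\<close> norm of its derivative. Hence the means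
  that enter the norm control all lower derivatives, at the price of one unit per order.
\<close>

lemma sobolev_L1_step:
  assumes f: "f \<in> sobolev s" and n: "sobolev_norm s f \<le> 1" and l: "l < s"
  shows "integral {0..1} (\<lambda>x. cmod (ivl_deriv l f x)) \<le> 1 + integral {0..1} (\<lambda>x. cmod (ivl_deriv (Suc l) f x))"
proof -
  let ?D = "ivl_deriv l f"
  let ?M = "integral {0..1} (\<lambda>x. cmod (ivl_deriv (Suc l) f x))"
  have iD: "?D integrable_on {0..1}" "(\<lambda>x. cmod (?D x)) integrable_on {0..1}"
    using sobolev_absolutely_integrable[OF f] l by (auto simp: absolutely_integrable_on_def)
  have incr: "cmod (?D x - ?D y) \<le> ?M" if xy: "x \<in> {0..1}" "y \<in> {0..1}" "y \<le> x" for x y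
  proof -
    have "cmod (?D x - ?D y) \<le> integral {y..1} (\<lambda>x. cmod (ivl_deriv (Suc l) f x))"
      using xy by (intro sobolev_increment_le[OF f l]) auto
    also have "\<dots> \<le> ?M"
      using absolutely_integrable_on_subinterval[OF sobolev_absolutely_integrable[OF f], of "Suc l" y 1]
        sobolev_absolutely_integrable[OF f, of "Suc l"] l xy
      by (intro integral_subset_le) (auto simp: absolutely_integrable_on_def)
    finally show ?thesis .
  qed
  have bd: "cmod (?D x) \<le> 1 + ?M" if x: "x \<in> {0..1}" for x
  proof -
    have "?D x - integral {0..1} ?D = integral {0..1} (\<lambda>y. ?D x - ?D y)"
      using iD by (subst integral_diff) auto
    moreover have "cmod (integral {0..1} (\<lambda>y. ?D x - ?D y)) \<le> integral {0..1} (\<lambda>y::real. ?M)"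
    proof (rule integral_norm_bound_integral)
      show "cmod (?D x - ?D y) \<le> ?M" if "y \<in> {0..1}" for y
        using incr[of x y] incr[of y x] x that by (cases "y \<le> x") (auto simp: norm_minus_commute)
    qed (use iD in \<open>auto intro: integrable_diff\<close>)
    moreover have "cmod (integral {0..1} ?D) \<le> 1"
      by (rule sobolev_unit_ball(2)[OF f n l])
    ultimately have "cmod (?D x - integral {0..1} ?D) \<le> ?M" "cmod (integral {0..1} ?D) \<le> 1"
      by simp_all
    then show ?thesis
      using norm_triangle_sub[of "?D x" "integral {0..1} ?D"] by simp
  qed
  have "integral {0..1} (\<lambda>x. cmod (?D x)) \<le> integral {0..1} (\<lambda>x::real. 1 + ?M)"
    using iD bd by (intro integral_le) auto
  then show ?thesis by simp
qed

lemma sobolev_L1_le: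
  assumes f: "f \<in> sobolev s" and n: "sobolev_norm s f \<le> 1" and l: "l \<le> s"
  shows "integral {0..1} (\<lambda>x. cmod (ivl_deriv l f x)) \<le> real (s - l) + 1"
  using l
proof (induction l rule: inc_induct)
  case base
  then show ?case using sobolev_top_L1_le[OF f n] by simp
next
  case (step l)
  then show ?case using sobolev_L1_step[OF f n, of l] by (simp add: Suc_diff_Suc of_nat_diff)
qed

section \<open>Oscillatory integrals and integration by parts\<close>

definition osc_freq :: "int \<Rightarrow> complex" where
  "osc_freq k = - 2 * of_real pi * \<i> * of_int k"

definition osc_exp :: "int \<Rightarrow> real \<Rightarrow> complex" where
  "osc_exp k x = exp (osc_freq k * of_real x)"

lemma norm_osc_freq: "cmod (osc_freq k) = 2 * pi * \<bar>real_of_int k\<bar>"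
  by (simp add: osc_freq_def norm_mult)

lemma osc_freq_neq_0: "k \<noteq> 0 \<Longrightarrow> osc_freq k \<noteq> 0"
  by (simp add: osc_freq_def)

lemma osc_exp_eq_cis: "osc_exp k x = cis (- 2 * pi * real_of_int k * x)"
  by (simp add: osc_exp_def osc_freq_def cis_conv_exp mult_ac)

lemma norm_osc_exp [simp]: "cmod (osc_exp k x) = 1"
  by (simp add: osc_exp_eq_cis)

lemma osc_exp_0 [simp]: "osc_exp k 0 = 1"
  by (simp add: osc_exp_def)

lemma osc_exp_1 [simp]: "osc_exp k 1 = 1"
proof -
  have "osc_exp k 1 = cis (2 * pi * real_of_int (- k))"
    by (simp add: osc_exp_eq_cis)
  also have "\<dots> = 1" by (rule cis_multiple_2pi) simp
  finally show ?thesis .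
qed

lemma osc_exp_has_vector_derivative:
  "(osc_exp k has_vector_derivative osc_freq k * osc_exp k x) (at x within S)"
  unfolding osc_exp_def
  by (auto intro!: derivative_eq_intros has_vector_derivative_real_field simp: mult_ac)

lemma continuous_on_osc_exp [continuous_intros]: "continuous_on S (osc_exp k)"
  unfolding osc_exp_def by (intro continuous_intros)

lemma sobolev_mult_continuous:
  assumes f: "f \<in> sobolev s" and l: "l \<le> s" and h: "continuous_on {0..1} h"
  shows "(\<lambda>x. ivl_deriv l f x * h x) absolutely_integrable_on {0..1}"
proof -
  have hm: "h \<in> borel_measurable (lebesgue_on {0..1})"
    by (intro continuous_imp_measurable_on_sets_lebesgue h) simp
  have "bounded (h ` {0..1})"
    by (intro compact_imp_bounded compact_continuous_image h compact_Icc)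
  from absolutely_integrable_bounded_measurable_product[OF bilinear_times hm _ this
      sobolev_absolutely_integrable[OF f l]]
  show ?thesis by (simp add: mult.commute)
qed

lemma osc_integral_eq:
  assumes "f \<in> sobolev s" "s \<ge> 1"
  shows "osc_integral k f = integral {0..1} (\<lambda>x. ivl_deriv 0 f x * osc_exp k x)"
proof -
  have "integrable (lebesgue_on {0..1}) (\<lambda>x. ivl_deriv 0 f x * osc_exp k x)"
    by (intro absolutely_integrable_imp_integrable sobolev_mult_continuous[OF assms(1)] continuous_intros) auto
  then have "integral {0..1} (\<lambda>x. ivl_deriv 0 f x * osc_exp k x)
      = (LINT x|lebesgue_on {0..1}. ivl_deriv 0 f x * osc_exp k x)"
    by (intro lebesgue_integral_eq_integral[symmetric]) auto
  then show ?thesis by (simp add: osc_integral_def osc_exp_def osc_freq_def)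
qed

text \<open>
  The constant \<open>z\<close> is free because an antiderivative of the kernel is determined only up to a
  constant: \<open>z = 0\<close> iterates well, while \<open>z = 1\<close> removes the boundary terms.
\<close>

lemma osc_by_parts:
  assumes f: "f \<in> sobolev s" and l: "l < s" and k: "k \<noteq> 0"
  shows "integral {0..1} (\<lambda>x. ivl_deriv l f x * osc_exp k x) =
      (ivl_deriv l f 1 * (1 - z) - ivl_deriv l f 0 * (1 - z)) / osc_freq k
      - integral {0..1} (\<lambda>x. ivl_deriv (Suc l) f x * (osc_exp k x - z)) / osc_freq k"
proof -
  let ?D = "ivl_deriv l f" and ?D' = "ivl_deriv (Suc l) f" and ?K = "osc_freq k"
  have "((\<lambda>x. ?D x * (?K * osc_exp k x) + ?D' x * (osc_exp k x - z)) has_integral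
      (?D 1 * (osc_exp k 1 - z) - ?D 0 * (osc_exp k 0 - z))) {0..1}"
    by (rule sobolev_by_parts[OF f l])
      (auto intro!: derivative_eq_intros osc_exp_has_vector_derivative continuous_intros)
  moreover have "(\<lambda>x. ?D x * (?K * osc_exp k x)) integrable_on {0..1}"
      "(\<lambda>x. ?D' x * (osc_exp k x - z)) integrable_on {0..1}"
    using l by (auto intro!: set_lebesgue_integral_eq_integral sobolev_mult_continuous[OF f] continuous_intros)
  ultimately have "?D 1 * (1 - z) - ?D 0 * (1 - z)
      = integral {0..1} (\<lambda>x. ?D x * (?K * osc_exp k x)) + integral {0..1} (\<lambda>x. ?D' x * (osc_exp k x - z))"
    by (simp add: integral_unique integral_add[symmetric])
  also have "integral {0..1} (\<lambda>x. ?D x * (?K * osc_exp k x)) = ?K * integral {0..1} (\<lambda>x. ?D x * osc_exp k x)"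
    by (simp add: mult.left_commute flip: integral_mult_right)
  finally show ?thesis using osc_freq_neq_0[OF k] by (simp add: field_simps)
qed

text \<open>
  Integrating by parts \<open>n\<close> times leaves boundary terms that use derivative values at the two end
  points only, and a remainder with a factor of modulus \<open>(2 pi |k|) ^ (-n)\<close>. The kernel has period \<open>1\<close>,
  so it takes the value \<open>1\<close> at both end points.
\<close>

lemma osc_boundary_expansion:
  assumes f: "f \<in> sobolev s" and k: "k \<noteq> 0" and n: "n \<le> s"
  shows "integral {0..1} (\<lambda>x. ivl_deriv 0 f x * osc_exp k x) =
      (\<Sum>l<n. (- 1) ^ l / osc_freq k ^ Suc l * (ivl_deriv l f 1 - ivl_deriv l f 0))
      + (- 1 / osc_freq k) ^ n * integral {0..1} (\<lambda>x. ivl_deriv n f x * osc_exp k x)"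
  using n
proof (induction n)
  case 0
  then show ?case by simp
next
  case (Suc n)
  then have "integral {0..1} (\<lambda>x. ivl_deriv n f x * osc_exp k x) = (ivl_deriv n f 1 - ivl_deriv n f 0) / osc_freq k
      - integral {0..1} (\<lambda>x. ivl_deriv (Suc n) f x * osc_exp k x) / osc_freq k"
    using osc_by_parts[OF f _ k, of n 0] by simp
  moreover have "(- (1 / osc_freq k)) ^ n = (- 1) ^ n / osc_freq k ^ n"
    by (metis minus_divide_left power_divide)
  ultimately show ?case
    using Suc by (simp add: mult.commute right_diff_distrib diff_divide_distrib)
qed

lemma osc_remainder_le:
  assumes f: "f \<in> sobolev s" and n: "sobolev_norm s f \<le> 1"
  shows "cmod (integral {0..1} (\<lambda>x. ivl_deriv s f x * osc_exp k x)) \<le> 1"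
  by (rule sobolev_top_mult_le[OF f n]) (auto intro: continuous_intros)

text \<open>
  The antiderivative of the kernel that vanishes at both end points leaves no boundary terms. So the
  integral costs one factor \<open>1 / |k|\<close> against the \<open>L\<^sub>1\<close> norm of the first derivative,
  and higher smoothness cannot improve this order.
\<close>

lemma osc_integral_le:
  assumes f: "f \<in> sobolev s" and s: "s \<ge> 1" and n: "sobolev_norm s f \<le> 1" and k: "k \<noteq> 0"
  shows "cmod (osc_integral k f) \<le> real s / (pi * \<bar>real_of_int k\<bar>)"
proof -
  let ?h = "\<lambda>x. osc_exp k x - 1"
  have eq: "osc_integral k f = - integral {0..1} (\<lambda>x. ivl_deriv 1 f x * ?h x) / osc_freq k"
    using osc_by_parts[OF f _ k, of 0 1] s by (simp add: osc_integral_eq[OF f s])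
  have "cmod (integral {0..1} (\<lambda>x. ivl_deriv 1 f x * ?h x)) \<le> integral {0..1} (\<lambda>x. cmod (ivl_deriv 1 f x) * 2)"
  proof (rule integral_norm_bound_integral)
    show "(\<lambda>x. ivl_deriv 1 f x * ?h x) integrable_on {0..1}"
      using s by (auto intro!: set_lebesgue_integral_eq_integral sobolev_mult_continuous[OF f] continuous_intros)
    show "(\<lambda>x. cmod (ivl_deriv 1 f x) * 2) integrable_on {0..1}"
      using sobolev_absolutely_integrable[OF f s]
      by (intro integrable_on_mult_left) (auto simp: absolutely_integrable_on_def)
    show "norm (ivl_deriv 1 f x * ?h x) \<le> cmod (ivl_deriv 1 f x) * 2" for x
      using norm_triangle_ineq4[of "osc_exp k x" 1] by (auto simp: norm_mult intro!: mult_left_mono)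
  qed
  also have "\<dots> = integral {0..1} (\<lambda>x. cmod (ivl_deriv 1 f x)) * 2" by simp
  also have "\<dots> \<le> real s * 2"
    using sobolev_L1_le[OF f n s] s by (simp add: of_nat_diff)
  finally have "cmod (integral {0..1} (\<lambda>x. ivl_deriv 1 f x * ?h x)) / (2 * pi * \<bar>real_of_int k\<bar>)
      \<le> real s * 2 / (2 * pi * \<bar>real_of_int k\<bar>)"
    by (intro divide_right_mono) auto
  then show ?thesis by (simp add: eq norm_divide norm_osc_freq)
qed

lemma integral_norm_osc_exp_diff_sq:
  assumes "k \<noteq> 0"
  shows "integral {0..1} (\<lambda>x. (cmod (osc_exp k x - 1))\<^sup>2) = 2"
proof -
  let ?c = "2 * pi * real_of_int k"
  have "((\<lambda>x. 2 - 2 * cos (?c * x)) has_integral (2 * 1 - 2 * sin (?c * 1) / ?c) - (2 * 0 - 2 * sin (?c * 0) / ?c)) {0..1}"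
    by (rule fundamental_theorem_of_calculus)
      (use assms in \<open>auto intro!: derivative_eq_intros simp flip: has_real_derivative_iff_has_vector_derivative\<close>)
  moreover have "sin (?c * 1) = 0" using sin_int_times_real[of k "2 * pi"] sin_integer_2pi[of "real_of_int k"]
    by (simp add: mult_ac)
  moreover have "(cmod (osc_exp k x - 1))\<^sup>2 = 2 - 2 * cos (?c * x)" for x
  proof -
    have "(cmod (osc_exp k x - 1))\<^sup>2 = (cos (?c * x) - 1)\<^sup>2 + (sin (?c * x))\<^sup>2"
      by (simp add: osc_exp_eq_cis cmod_power2)
    also have "\<dots> = (cos (?c * x))\<^sup>2 + (sin (?c * x))\<^sup>2 + 1 - 2 * cos (?c * x)"
      by (simp add: power2_diff)
    finally show ?thesis by simp
  qed
  ultimately show ?thesis by (simp add: integral_unique)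
qed

text \<open>
  For smoothness \<open>1\<close> the constant decides the threshold on the tolerance, so the \<open>L\<^sub>1\<close> estimate
  is replaced by the exact \<open>L\<^sub>2\<close> norm of the normalised antiderivative, which is
  \<open>sqrt 2 / (2 pi |k|)\<close>.
\<close>

lemma osc_integral_le_smoothness_1:
  assumes f: "f \<in> sobolev 1" and n: "sobolev_norm 1 f \<le> 1" and k: "k \<noteq> 0"
  shows "cmod (osc_integral k f) \<le> 1 / (sqrt 2 * pi * \<bar>real_of_int k\<bar>)"
proof -
  let ?h = "\<lambda>x. osc_exp k x - 1"
  have eq: "osc_integral k f = - integral {0..1} (\<lambda>x. ivl_deriv 1 f x * ?h x) / osc_freq k"
    using osc_by_parts[OF f _ k, of 0 1] by (simp add: osc_integral_eq[OF f])
  have "cmod (integral {0..1} (\<lambda>x. ivl_deriv 1 f x * ?h x)) \<le> sqrt 2"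
    by (rule sobolev_top_mult_le[OF f n]) (auto intro!: continuous_intros simp: integral_norm_osc_exp_diff_sq[OF k])
  then have "cmod (osc_integral k f) \<le> sqrt 2 / (2 * pi * \<bar>real_of_int k\<bar>)"
    by (auto simp: eq norm_divide norm_osc_freq intro!: divide_right_mono)
  also have "\<dots> = 1 / (sqrt 2 * pi * \<bar>real_of_int k\<bar>)"
    using k by (simp add: field_simps)
  finally show ?thesis .
qed

text \<open>
  A linear function shows that the initial error decays no faster than \<open>1 / |k|\<close>, whatever the
  smoothness: it is not periodic, and its derivatives of order two and more vanish. The factor \<open>1/2\<close>
  puts it into the unit ball for every \<open>s\<close>.
\<close>

lemma half_id_sobolev:
  defines "f \<equiv> \<lambda>x. complex_of_real (x / 2)"
  assumes s: "s \<ge> 1"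
  shows "f \<in> sobolev s" "sobolev_norm s f \<le> 1"
proof -
  have vd: "vector_derivative g (at x within {0..1}) = d"
    if "(g has_vector_derivative d) (at x within {0..1})" "x \<in> {0..1}" for g :: "real \<Rightarrow> complex" and d x
    using vector_derivative_within_closed_interval[OF _ that(2,1)] by simp
  have f': "(f has_vector_derivative 1/2) (at x within {0..1})" for x
    unfolding f_def by (auto intro!: derivative_eq_intros has_vector_derivative_real_field)
  have D1: "ivl_deriv 1 f x = 1/2" if "x \<in> {0..1}" for x
    using vd[OF f' that] by (simp add: ivl_deriv.simps(2))
  have D1': "(ivl_deriv 1 f has_vector_derivative 0) (at x within {0..1})" if "x \<in> {0..1}" for x
    by (rule has_vector_derivative_transform[OF that D1]) auto
  have D2: "\<forall>x\<in>{0..1}. ivl_deriv (Suc (Suc n)) f x = 0" for n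
  proof (induction n)
    case 0
    then show ?case using vd[OF D1'] by (simp add: ivl_deriv.simps(2))
  next
    case (Suc n)
    have "(ivl_deriv (Suc (Suc n)) f has_vector_derivative 0) (at x within {0..1})" if "x \<in> {0..1}" for x
      by (rule has_vector_derivative_transform[OF that]) (use Suc in auto)
    then show ?case using vd by (simp add: ivl_deriv.simps(2))
  qed
  have diff: "\<exists>d. (ivl_deriv l f has_vector_derivative d) (at x within {0..1})" if "x \<in> {0..1}" for l x
  proof (cases l)
    case 0 then show ?thesis using f' by auto
  next
    case (Suc m)
    show ?thesis
    proof (cases m)
      case 0 then show ?thesis using Suc D1'[OF that] by auto
    next
      case (Suc n)
      have "(ivl_deriv (Suc (Suc n)) f has_vector_derivative 0) (at x within {0..1})"
        by (rule has_vector_derivative_transform[OF that]) (use D2 in auto)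
      then show ?thesis using Suc \<open>l = Suc m\<close> by auto
    qed
  qed
  have dff: "ivl_deriv l f differentiable (at x within {0..1})" if "x \<in> {0..1}" for l x
    using diff[OF that] by (blast intro: differentiableI_vector)
  have cont: "continuous_on {0..1} (ivl_deriv l f)" for l
    using dff by (intro differentiable_imp_continuous_on) (auto simp: differentiable_on_def)
  have ac: "abs_cont_on {0..1} (ivl_deriv l f)" for l
    by (rule continuous_deriv_imp_abs_cont_on[of _ _ _ "ivl_deriv (Suc l) f", OF _ cont])
      (use dff in \<open>auto simp: vector_derivative_works ivl_deriv.simps(2)\<close>)
  have sq: "square_integrable_on (ivl_deriv s f) {0..1}"
    unfolding square_integrable_on_def
    by (intro conjI continuous_imp_measurable_on_sets_lebesgue cont absolutely_integrable_imp_integrable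
        absolutely_integrable_continuous_real continuous_intros) auto
  have "AE x in lebesgue_on {0..1}. ivl_deriv (s - 1) f differentiable (at x within {0..1})"
    using dff by (intro AE_I2) auto
  then show S: "f \<in> sobolev s"
    using dff ac sq by (auto simp: sobolev_def)
  have "((\<lambda>x. x / 2) has_integral 1\<^sup>2/4 - 0\<^sup>2/4) {0..1::real}"
    by (rule fundamental_theorem_of_calculus)
      (auto intro!: derivative_eq_intros simp flip: has_real_derivative_iff_has_vector_derivative)
  then have "(f has_integral of_real (1/4)) {0..1}"
    unfolding f_def by (intro has_integral_of_real) simp
  then have I0: "integral {0..1} (ivl_deriv 0 f) = 1/4" by (simp add: integral_unique)
  have I1: "integral {0..1} (ivl_deriv 1 f) = 1/2"
    using D1 by (subst integral_cong[of _ _ "\<lambda>_. 1/2"]) auto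
  have I2: "integral {0..1} (ivl_deriv (Suc (Suc n)) f) = 0" for n
    using D2 by (subst integral_cong[of _ _ "\<lambda>_. 0"]) auto
  \<comment> \<open>The squared norm is \<open>1/16 + 1/4\<close>. For \<open>s = 1\<close> the summand \<open>1/4\<close> comes from the top order
      term, otherwise from the mean of the first derivative.\<close>
  have c: "(cmod (integral {0..1} (ivl_deriv 0 f)))\<^sup>2 = 1/16" "(cmod (integral {0..1} (ivl_deriv 1 f)))\<^sup>2 = 1/4"
    "(cmod (integral {0..1} (ivl_deriv (Suc (Suc n)) f)))\<^sup>2 = 0" for n
    unfolding I0 I1 I2 by (simp_all add: norm_divide power2_eq_square)
  have "Re (sobolev_inner s f f) \<le> 1"
  proof (cases "s = 1")
    case True
    have "integral {0..1} (\<lambda>x. (cmod (ivl_deriv 1 f x))\<^sup>2) = 1/4"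
      by (subst integral_cong[of _ _ "\<lambda>_. 1/4"]) (simp_all only: D1, simp_all add: norm_divide power2_eq_square)
    then show ?thesis
      unfolding sobolev_inner_self[OF S] Re_complex_of_real using True c(1) by simp
  next
    case False
    then have n: "s = Suc (Suc (s - 2))" using s by simp
    have "integral {0..1} (\<lambda>x. (cmod (ivl_deriv s f x))\<^sup>2) = 0"
      by (subst n, subst integral_cong[of _ _ "\<lambda>_. 0"]) (use D2 in auto)
    moreover have "(\<Sum>l<s. (cmod (integral {0..1} (ivl_deriv l f)))\<^sup>2) = 1/16 + 1/4"
      by (subst n) (use c in \<open>simp add: sum.lessThan_Suc_shift del: sum.lessThan_Suc\<close>)
    ultimately show ?thesis unfolding sobolev_inner_self[OF S] Re_complex_of_real by simp
  qed
  then show "sobolev_norm s f \<le> 1" by (simp add: sobolev_norm_def)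
qed

lemma osc_integral_half_id:
  assumes k: "k \<noteq> 0"
  shows "cmod (osc_integral k (\<lambda>x. complex_of_real (x / 2))) = 1 / (4 * pi * \<bar>real_of_int k\<bar>)"
proof -
  define f where "f = (\<lambda>x. complex_of_real (x / 2))"
  let ?K = "osc_freq k"
  have f: "f \<in> sobolev 1" using half_id_sobolev[of 1] by (simp add: f_def)
  have "((\<lambda>x. f x * osc_exp k x) has_integral
      (f 1 * osc_exp k 1 / ?K - osc_exp k 1 / (2 * ?K\<^sup>2)) - (f 0 * osc_exp k 0 / ?K - osc_exp k 0 / (2 * ?K\<^sup>2))) {0..1}"
  proof (rule fundamental_theorem_of_calculus)
    fix x :: real
    have f': "(f has_vector_derivative 1/2) (at x within {0..1})" for x
      unfolding f_def by (auto intro!: derivative_eq_intros has_vector_derivative_real_field)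
    show "((\<lambda>x. f x * osc_exp k x / ?K - osc_exp k x / (2 * ?K\<^sup>2)) has_vector_derivative f x * osc_exp k x)
        (at x within {0..1})"
      using osc_freq_neq_0[OF k]
      by (auto intro!: derivative_eq_intros f' osc_exp_has_vector_derivative simp: field_simps power2_eq_square)
  qed simp
  from integral_unique[OF this] have "integral {0..1} (\<lambda>x. f x * osc_exp k x) = 1 / (2 * ?K)"
    by (simp add: f_def)
  then have "osc_integral k f = 1 / (2 * ?K)"
    using osc_integral_eq[OF f] by simp
  then show ?thesis by (simp add: f_def norm_divide norm_mult norm_osc_freq)
qed

section \<open>Taylor expansion on a small interval\<close>

text \<open>
  This is the Taylor polynomial of degree \<open>s - 1 - l\<close> of the \<open>l\<close>-th derivative. The family is indexed by
  \<open>l\<close> so that differentiation raises the index, exactly as for \<^const>\<open>ivl_deriv\<close>.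
\<close>

definition taylor_poly :: "nat \<Rightarrow> (real \<Rightarrow> complex) \<Rightarrow> real \<Rightarrow> nat \<Rightarrow> real \<Rightarrow> complex" where
  "taylor_poly s f a l x = (\<Sum>j<s - l. ivl_deriv (l + j) f a * (of_real (x - a) ^ j / fact j))"

lemma continuous_on_taylor_poly: "continuous_on S (taylor_poly s f a l)"
  unfolding taylor_poly_def by (intro continuous_intros) auto

lemma taylor_poly_at_center: "l < s \<Longrightarrow> taylor_poly s f a l a = ivl_deriv l f a"
  by (simp add: taylor_poly_def sum.lessThan_Suc_shift Suc_diff_Suc[symmetric] del: sum.lessThan_Suc)

lemma taylor_poly_has_vector_derivative:
  assumes "l < s"
  shows "(taylor_poly s f a l has_vector_derivative taylor_poly s f a (Suc l) x) (at x within S)"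
proof -
  have monom: "((\<lambda>x. of_real (x - a) ^ Suc i / fact (Suc i)) has_vector_derivative (of_real (x - a) ^ i / fact i :: complex)) (at x within S)" for i
  proof -
    have A: "((\<lambda>z. (z - of_real a) ^ Suc i / fact (Suc i)) has_field_derivative
        (of_nat (Suc i) * (of_real x - of_real a) ^ i / fact (Suc i) :: complex)) (at (of_real x))"
      by (auto intro!: derivative_eq_intros simp del: power_Suc fact_Suc)
    have eq: "of_nat (Suc i) * (of_real x - of_real a) ^ i / fact (Suc i) = (of_real (x - a) ^ i / fact i :: complex)"
      by (simp add: field_simps del: of_nat_Suc)
    have "((\<lambda>x. (of_real x - of_real a) ^ Suc i / fact (Suc i)) has_vector_derivative
        (of_real (x - a) ^ i / fact i :: complex)) (at x within S)"
      using has_vector_derivative_real_field[OF A] unfolding eq .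
    then show ?thesis by (simp add: of_real_diff)
  qed
  have "((\<lambda>x. ivl_deriv l f a + (\<Sum>i<s - Suc l. ivl_deriv (l + Suc i) f a * (of_real (x - a) ^ Suc i / fact (Suc i))))
      has_vector_derivative 0 + (\<Sum>i<s - Suc l. ivl_deriv (l + Suc i) f a * (of_real (x - a) ^ i / fact i))) (at x within S)"
    by (intro has_vector_derivative_add has_vector_derivative_const has_vector_derivative_sum
        has_vector_derivative_mult_right monom)
  moreover have "taylor_poly s f a l = (\<lambda>x. ivl_deriv l f a
      + (\<Sum>i<s - Suc l. ivl_deriv (l + Suc i) f a * (of_real (x - a) ^ Suc i / fact (Suc i))))"
    using assms by (simp add: taylor_poly_def fun_eq_iff sum.lessThan_Suc_shift Suc_diff_Suc[symmetric]
        del: sum.lessThan_Suc power_Suc fact_Suc)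
  moreover have "taylor_poly s f a (Suc l) x
      = (\<Sum>i<s - Suc l. ivl_deriv (l + Suc i) f a * (of_real (x - a) ^ i / fact i))"
    by (simp add: taylor_poly_def)
  ultimately show ?thesis by simp
qed

text \<open>
  The remainder of the highest order is an increment of an absolutely continuous function; each
  integration from the centre gains a factor \<open>b - a\<close>.
\<close>

lemma taylor_remainder_le:
  assumes f: "f \<in> sobolev s" and l: "l < s" and ab: "0 \<le> a" "b \<le> 1" and x: "x \<in> {a..b}"
  shows "cmod (ivl_deriv l f x - taylor_poly s f a l x)
      \<le> (b - a) ^ (s - Suc l) * integral {a..b} (\<lambda>t. cmod (ivl_deriv s f t))"
proof -
  let ?M = "integral {a..b} (\<lambda>t. cmod (ivl_deriv s f t))"
  have "{a..b} \<subseteq> {0..1}" using ab by auto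
  from absolutely_integrable_on_subinterval[OF sobolev_absolutely_integrable[OF f order_refl] this]
  have M: "0 \<le> ?M" by (intro integral_nonneg) (auto simp: absolutely_integrable_on_def)
  have "l \<le> s - 1" using l by simp
  then have "\<forall>x\<in>{a..b}. cmod (ivl_deriv l f x - taylor_poly s f a l x) \<le> (b - a) ^ (s - Suc l) * ?M"
  proof (induction l rule: inc_induct)
    case base
    have s: "Suc (s - 1) = s" "s - (s - 1) = 1" using l by auto
    show ?case
    proof
      fix x assume x: "x \<in> {a..b}"
      have "cmod (ivl_deriv (s - 1) f x - ivl_deriv (s - 1) f a) \<le> ?M"
        using sobolev_increment_le[OF f, of "s - 1" a x b] ab x l s by auto
      then show "cmod (ivl_deriv (s - 1) f x - taylor_poly s f a (s - 1) x) \<le> (b - a) ^ (s - Suc (s - 1)) * ?M"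
        unfolding taylor_poly_def s by simp
    qed
  next
    case (step l)
    let ?R = "\<lambda>l x. ivl_deriv l f x - taylor_poly s f a l x"
    show ?case
    proof
      fix x assume x: "x \<in> {a..b}"
      let ?B = "(b - a) ^ (s - Suc (Suc l)) * ?M"
      have "(?R (Suc l) has_integral (?R l x - ?R l a)) {a..x}"
      proof (rule fundamental_theorem_of_calculus)
        fix t assume t: "t \<in> {a..x}"
        then have "(ivl_deriv l f has_vector_derivative ivl_deriv (Suc l) f t) (at t within {a..x})"
          using x ab step by (intro has_vector_derivative_within_subset[OF sobolev_differentiable[OF f]]) auto
        then show "(?R l has_vector_derivative ?R (Suc l) t) (at t within {a..x})"
          using step by (intro has_vector_derivative_diff taylor_poly_has_vector_derivative) auto
      qed (use x in auto)
      moreover have "?R l a = 0" using step by (simp add: taylor_poly_at_center)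
      ultimately have int: "(?R (Suc l) has_integral ?R l x) {a..x}" by simp
      have "cmod (?R l x) \<le> ?B * (x - a)"
        using has_integral_bound_real[OF _ _ int, of ?B "{}"] step x M by auto
      also have "\<dots> \<le> ?B * (b - a)"
        using x M by (intro mult_left_mono) auto
      also have "\<dots> = (b - a) ^ (s - Suc l) * ?M"
      proof -
        have "s - Suc l = Suc (s - Suc (Suc l))" using step by simp
        then show ?thesis by simp
      qed
      finally show "cmod (?R l x) \<le> (b - a) ^ (s - Suc l) * ?M" .
    qed
  qed
  with x show ?thesis by blast
qed

section \<open>Worst case errors\<close>

lemma error_sobolev_le:
  assumes "A \<in> algorithms n s"
    and "\<And>f. \<lbrakk>f \<in> sobolev s; sobolev_norm s f \<le> 1\<rbrakk> \<Longrightarrow> cmod (osc_integral k f - A f) \<le> b"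
  shows "error_sobolev n k s \<le> ereal b"
  unfolding error_sobolev_def min_error_def
  by (rule INF_lower2[OF assms(1)]) (auto intro!: SUP_least assms(2))

lemma algorithms_0: "algorithms 0 s = {\<lambda>f. 0}"
  by (auto simp: algorithms_def)

lemma osc_integral_le_initial_error:
  assumes "f \<in> sobolev s" "sobolev_norm s f \<le> 1"
  shows "ereal (cmod (osc_integral k f)) \<le> error_sobolev 0 k s"
  unfolding error_sobolev_def min_error_def algorithms_0
  using assms by (auto intro!: SUP_upper2[of f])

lemma error_periodic_le_error_sobolev: "error_periodic n k s \<le> error_sobolev n k s"
  unfolding error_sobolev_def error_periodic_def min_error_def
  by (intro INF_mono' SUP_subset_mono) (auto simp: periodic_sobolev_def)

lemma algorithms_Suc_mono:
  assumes "s \<ge> 1"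
  shows "algorithms n s \<subseteq> algorithms (Suc n) s"
proof
  fix A assume "A \<in> algorithms n s"
  then obtain a l x where A: "A = (\<lambda>f. \<Sum>j<n. a j * ivl_deriv (l j) f (x j))" "\<forall>j<n. l j < s \<and> x j \<in> {0..1}"
    by (auto simp: algorithms_def)
  have "A = (\<lambda>f. \<Sum>j<Suc n. (a(n := 0)) j * ivl_deriv ((l(n := 0)) j) f ((x(n := 0)) j))"
    unfolding A(1) by (auto simp: fun_eq_iff intro!: sum.cong)
  moreover have "\<forall>j<Suc n. (l(n := 0)) j < s \<and> (x(n := 0)) j \<in> {0..1}"
    using A(2) assms by (auto simp: less_Suc_eq)
  ultimately show "A \<in> algorithms (Suc n) s"
    unfolding algorithms_def by blast
qed

lemma error_sobolev_antimono:
  assumes "s \<ge> 1" "n \<le> m"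
  shows "error_sobolev m k s \<le> error_sobolev n k s"
  using assms(2)
proof (induction m rule: dec_induct)
  case (step m)
  have "error_sobolev (Suc m) k s \<le> error_sobolev m k s"
    unfolding error_sobolev_def min_error_def
    by (intro INF_superset_mono algorithms_Suc_mono assms(1)) auto
  then show ?case using step.IH by order
qed simp

text \<open>
  Both constructions below use all \<open>s\<close> derivative values at each of \<open>m\<close> nodes. Division with
  remainder by \<open>s\<close> arranges them in one sequence.
\<close>

lemma nodewise_algorithm:
  assumes "\<And>i. i < m \<Longrightarrow> x i \<in> {0..1}"
  shows "(\<lambda>f. \<Sum>i<m. \<Sum>l<s. c i l * ivl_deriv l f (x i)) \<in> algorithms (m * s) s"
proof -
  have "(\<Sum>i<m. \<Sum>l<s. c i l * ivl_deriv l f (x i))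
      = (\<Sum>j<m * s. c (j div s) (j mod s) * ivl_deriv (j mod s) f (x (j div s)))" for f
  proof -
    have "(\<Sum>l<s. c i l * ivl_deriv l f (x i))
        = (\<Sum>j = i * s..<i * s + s. c (j div s) (j mod s) * ivl_deriv (j mod s) f (x (j div s)))" for i
      using sum.shift_bounds_nat_ivl[of "\<lambda>j. c (j div s) (j mod s) * ivl_deriv (j mod s) f (x (j div s))" 0 "i * s" s]
      by (simp add: lessThan_atLeast0 add.commute)
    then show ?thesis by (simp add: sum.nat_group)
  qed
  moreover have "j mod s < s \<and> x (j div s) \<in> {0..1}" if "j < m * s" for j
  proof -
    have "0 < s" using that by (cases s) auto
    then show ?thesis using assms[of "j div s"] that by (simp add: less_mult_imp_div_less)
  qed
  ultimately show ?thesis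
    unfolding algorithms_def
    by (intro CollectI exI[of _ "\<lambda>j. c (j div s) (j mod s)"] exI[of _ "\<lambda>j. j mod s"] exI[of _ "\<lambda>j. x (j div s)"])
      (auto simp: fun_eq_iff)
qed

text \<open>
  The boundary terms of the repeated integration by parts form an algorithm, whose error is the
  remainder integral. This is what makes high frequencies easy.
\<close>

lemma error_sobolev_endpoints_le:
  assumes s: "s \<ge> 1" and k: "k \<noteq> 0"
  shows "error_sobolev (2 * s) k s \<le> ereal (1 / (2 * pi * \<bar>real_of_int k\<bar>) ^ s)"
proof (rule error_sobolev_le)
  let ?c = "\<lambda>i l. (if i = 0 then - 1 else 1) * ((- 1) ^ l / osc_freq k ^ Suc l)"
  let ?A = "\<lambda>f. \<Sum>i<2. \<Sum>l<s. ?c i l * ivl_deriv l f (real i)"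
  show "?A \<in> algorithms (2 * s) s"
    by (rule nodewise_algorithm) auto
  fix f assume f: "f \<in> sobolev s" "sobolev_norm s f \<le> 1"
  have "?A f = (\<Sum>l<s. (- 1) ^ l / osc_freq k ^ Suc l * (ivl_deriv l f 1 - ivl_deriv l f 0))"
    by (simp add: numeral_2_eq_2 right_diff_distrib sum_subtractf sum_negf del: power_Suc)
  then have "osc_integral k f - ?A f = (- 1 / osc_freq k) ^ s * integral {0..1} (\<lambda>x. ivl_deriv s f x * osc_exp k x)"
    using osc_boundary_expansion[OF f(1) k order_refl] osc_integral_eq[OF f(1) s] by simp
  then have "cmod (osc_integral k f - ?A f)
      = (1 / (2 * pi * \<bar>real_of_int k\<bar>)) ^ s * cmod (integral {0..1} (\<lambda>x. ivl_deriv s f x * osc_exp k x))"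
    by (simp add: norm_mult norm_power norm_divide norm_osc_freq)
  also have "\<dots> \<le> (1 / (2 * pi * \<bar>real_of_int k\<bar>)) ^ s * 1"
    using osc_remainder_le[OF f] by (intro mult_left_mono) auto
  finally show "cmod (osc_integral k f - ?A f) \<le> 1 / (2 * pi * \<bar>real_of_int k\<bar>) ^ s"
    by (simp add: power_divide)
qed

lemma integral_split_uniform:
  fixes g :: "real \<Rightarrow> 'a::banach"
  assumes "0 \<le> h" "g integrable_on {0..real n * h}"
  shows "integral {0..real n * h} g = (\<Sum>i<n. integral {real i * h..real (Suc i) * h} g)"
  using assms(2)
proof (induction n)
  case (Suc n)
  have le: "0 \<le> real n * h" "real n * h \<le> real (Suc n) * h" using assms(1) by (auto intro: mult_right_mono)
  have "g integrable_on {0..real n * h}"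
    by (rule integrable_on_subinterval[OF Suc.prems]) (use le in auto)
  then show ?case
    using Suc.IH Henstock_Kurzweil_Integration.integral_combine[OF le Suc.prems] by simp
qed simp

text \<open>
  Replacing \<open>f\<close> by its Taylor polynomial on each of \<open>m\<close> subintervals of equal length. The bound
  does not depend on the frequency, because the kernel has modulus one.
\<close>

lemma error_sobolev_taylor_le:
  assumes s: "s \<ge> 1" and m: "m \<ge> 1"
  shows "error_sobolev (m * s) k s \<le> ereal ((1 / real m) ^ s)"
proof (rule error_sobolev_le)
  define h where "h = 1 / real m"
  have h: "0 < h" "real m * h = 1" using m by (auto simp: h_def)
  define J where "J i = {real i * h..real (Suc i) * h}" for i
  have J: "J i \<subseteq> {0..1}" "0 \<le> real i * h" "real (Suc i) * h \<le> 1" if "i < m" for i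
  proof -
    show "0 \<le> real i * h" using h by simp
    have "real (Suc i) * h \<le> real m * h" using that h(1) by (intro mult_right_mono) auto
    then show "real (Suc i) * h \<le> 1" using h(2) by simp
    then show "J i \<subseteq> {0..1}" using h(1) by (auto simp: J_def intro: order_trans[OF mult_nonneg_nonneg])
  qed
  let ?c = "\<lambda>i l. integral (J i) (\<lambda>x. of_real (x - real i * h) ^ l / fact l * osc_exp k x)"
  let ?A = "\<lambda>f. \<Sum>i<m. \<Sum>l<s. ?c i l * ivl_deriv l f (real i * h)"
  show "?A \<in> algorithms (m * s) s"
  proof (rule nodewise_algorithm)
    fix i assume i: "i < m"
    have "real i * h \<le> real (Suc i) * h" using h by (intro mult_right_mono) auto
    then show "real i * h \<in> {0..1}" using J[OF i] by auto
  qed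
  fix f assume f: "f \<in> sobolev s" "sobolev_norm s f \<le> 1"
  let ?T = "\<lambda>i. taylor_poly s f (real i * h) 0"
  let ?g = "\<lambda>x. ivl_deriv 0 f x * osc_exp k x"
  let ?M = "\<lambda>i. integral (J i) (\<lambda>t. cmod (ivl_deriv s f t))"
  have ig: "?g integrable_on {0..1}"
    by (intro set_lebesgue_integral_eq_integral sobolev_mult_continuous[OF f(1)] continuous_intros) auto
  have iM: "(\<lambda>t. cmod (ivl_deriv s f t)) integrable_on {0..1}"
    using sobolev_absolutely_integrable[OF f(1) order_refl] by (simp add: absolutely_integrable_on_def)
  have osc: "osc_integral k f = (\<Sum>i<m. integral (J i) ?g)"
    using integral_split_uniform[of h ?g m] h ig osc_integral_eq[OF f(1) s] by (simp add: J_def)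
  have piece: "(\<Sum>l<s. ?c i l * ivl_deriv l f (real i * h)) = integral (J i) (\<lambda>x. ?T i x * osc_exp k x)" for i
  proof -
    have "integral (J i) (\<lambda>x. ?T i x * osc_exp k x)
        = integral (J i) (\<lambda>x. \<Sum>l<s. ivl_deriv l f (real i * h) * (of_real (x - real i * h) ^ l / fact l * osc_exp k x))"
      by (simp add: taylor_poly_def sum_distrib_right mult.assoc)
    also have "\<dots> = (\<Sum>l<s. integral (J i) (\<lambda>x. ivl_deriv l f (real i * h) * (of_real (x - real i * h) ^ l / fact l * osc_exp k x)))"
      unfolding J_def by (intro integral_sum integrable_continuous_real continuous_intros) auto
    also have "\<dots> = (\<Sum>l<s. ?c i l * ivl_deriv l f (real i * h))"
      by (intro sum.cong refl) (simp only: integral_mult_right mult.commute)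
    finally show ?thesis ..
  qed
  have bound: "cmod (integral (J i) ?g - integral (J i) (\<lambda>x. ?T i x * osc_exp k x)) \<le> h ^ s * ?M i" if i: "i < m" for i
  proof -
    have int: "?g integrable_on J i" "(\<lambda>x. ?T i x * osc_exp k x) integrable_on J i"
      using integrable_on_subinterval[OF ig, of "real i * h" "real (Suc i) * h"] J[OF i]
      by (auto simp: J_def intro!: integrable_continuous_real continuous_intros continuous_on_taylor_poly)
    have w: "real (Suc i) * h - real i * h = h" by (simp add: algebra_simps)
    have "cmod (integral (J i) (\<lambda>x. ?g x - ?T i x * osc_exp k x)) \<le> integral (J i) (\<lambda>_. h ^ (s - 1) * ?M i)"
    proof (rule integral_norm_bound_integral)
      fix x assume x: "x \<in> J i"
      have "cmod (?g x - ?T i x * osc_exp k x) = cmod (ivl_deriv 0 f x - ?T i x)"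
        by (simp add: norm_mult flip: left_diff_distrib)
      also have "\<dots> \<le> h ^ (s - 1) * ?M i"
        using taylor_remainder_le[OF f(1), of 0 "real i * h" "real (Suc i) * h" x] J[OF i] s x
        unfolding w by (simp add: J_def)
      finally show "cmod (?g x - ?T i x * osc_exp k x) \<le> h ^ (s - 1) * ?M i" .
    qed (use int in \<open>auto intro!: integrable_diff simp: J_def\<close>)
    also have "\<dots> = h * (h ^ (s - 1) * ?M i)"
      using w h by (simp add: J_def mult_right_mono)
    also have "\<dots> = h ^ s * ?M i"
      using s by (simp add: power_eq_if)
    finally show ?thesis using int by (simp add: integral_diff)
  qed
  have "cmod (osc_integral k f - ?A f)
      = cmod (\<Sum>i<m. integral (J i) ?g - integral (J i) (\<lambda>x. ?T i x * osc_exp k x))"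
    unfolding osc piece by (simp add: sum_subtractf)
  also have "\<dots> \<le> (\<Sum>i<m. h ^ s * ?M i)"
    by (rule sum_norm_le) (use bound in auto)
  also have "\<dots> = h ^ s * integral {0..1} (\<lambda>t. cmod (ivl_deriv s f t))"
    using integral_split_uniform[of h "\<lambda>t. cmod (ivl_deriv s f t)" m] h iM
    by (simp add: J_def sum_distrib_left)
  also have "\<dots> \<le> h ^ s * 1"
    using sobolev_top_L1_le[OF f] h by (intro mult_left_mono) auto
  finally show "cmod (osc_integral k f - ?A f) \<le> (1 / real m) ^ s" by (simp add: h_def)
qed

lemma initial_error_le:
  assumes "s \<ge> 1" "k \<noteq> 0"
  shows "error_sobolev 0 k s \<le> ereal (real s / (pi * \<bar>real_of_int k\<bar>))"
  by (rule error_sobolev_le[of "\<lambda>_. 0"]) (use assms osc_integral_le in \<open>auto simp: algorithms_0\<close>)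

lemma initial_error_le_smoothness_1:
  assumes "k \<noteq> 0"
  shows "error_sobolev 0 k 1 \<le> ereal (1 / (sqrt 2 * pi * \<bar>real_of_int k\<bar>))"
proof (rule error_sobolev_le[of "\<lambda>_. 0"])
  show "cmod (osc_integral k f - 0) \<le> 1 / (sqrt 2 * pi * \<bar>real_of_int k\<bar>)"
    if "f \<in> sobolev 1" "sobolev_norm 1 f \<le> 1" for f
    using osc_integral_le_smoothness_1[OF that assms] by simp
qed (simp add: algorithms_0)

lemma initial_error_ge:
  assumes "s \<ge> 1" "k \<noteq> 0"
  shows "ereal (1 / (4 * pi * \<bar>real_of_int k\<bar>)) \<le> error_sobolev 0 k s"
  using osc_integral_le_initial_error[OF half_id_sobolev[OF assms(1)], of k] osc_integral_half_id[OF assms(2)] by simp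

section \<open>Information complexity\<close>

text \<open>
  Since the initial error is at least \<open>1 / (4 pi |k|)\<close>, an absolute error of \<open>\<epsilon>\<close> times this number
  meets the normalized criterion.
\<close>

lemma normalized_error_leI:
  assumes "s \<ge> 1" "k \<noteq> 0" "0 < \<epsilon>" "error_sobolev n k s \<le> ereal b" "b \<le> \<epsilon> / (4 * pi * \<bar>real_of_int k\<bar>)"
  shows "error_sobolev n k s \<le> ereal \<epsilon> * error_sobolev 0 k s"
proof -
  have "error_sobolev n k s \<le> ereal b" by fact
  also have "\<dots> \<le> ereal \<epsilon> * ereal (1 / (4 * pi * \<bar>real_of_int k\<bar>))"
    using assms(5) by simp
  also have "\<dots> \<le> ereal \<epsilon> * error_sobolev 0 k s"
    using assms(1-3) by (intro ereal_mult_left_mono initial_error_ge) auto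
  finally show ?thesis .
qed

lemma n_nor_le:
  assumes "s \<ge> 1" "k \<noteq> 0" "0 < \<epsilon>" "error_sobolev n k s \<le> ereal b" "b \<le> \<epsilon> / (4 * pi * \<bar>real_of_int k\<bar>)"
  shows "n_nor \<epsilon> k s \<le> n"
  unfolding n_nor_def using normalized_error_leI[OF assms] by (rule Least_le)

text \<open>
  The minimum that defines the information complexity exists, because the errors of the piecewise
  Taylor algorithms tend to \<open>0\<close>.
\<close>

lemma n_nor_attained:
  assumes s: "s \<ge> 1" and k: "k \<noteq> 0" and e: "0 < \<epsilon>"
  shows "error_sobolev (n_nor \<epsilon> k s) k s \<le> ereal \<epsilon> * error_sobolev 0 k s"
proof -
  define m where "m = nat \<lceil>4 * pi * \<bar>real_of_int k\<bar> / \<epsilon>\<rceil>"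
  have pos: "0 < 4 * pi * \<bar>real_of_int k\<bar> / \<epsilon>" using k e by simp
  have m: "4 * pi * \<bar>real_of_int k\<bar> / \<epsilon> \<le> real m" unfolding m_def by linarith
  with pos have m1: "m \<ge> 1" by (cases m) auto
  have "(1 / real m) ^ s \<le> 1 / real m"
    using s m1 power_decreasing[of 1 s "1 / real m"] by simp
  also have "\<dots> \<le> 1 / (4 * pi * \<bar>real_of_int k\<bar> / \<epsilon>)"
    using m pos m1 by (intro divide_left_mono mult_pos_pos) auto
  finally have "(1 / real m) ^ s \<le> \<epsilon> / (4 * pi * \<bar>real_of_int k\<bar>)" by simp
  from normalized_error_leI[OF s k e error_sobolev_taylor_le[OF s m1] this]
  show ?thesis unfolding n_nor_def by (rule LeastI)
qed

text \<open>
  The lower bound is applied with one additional function value, so that the case of a vanishing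
  information complexity needs no separate treatment.
\<close>

lemma n_nor_lower_bound:
  assumes s: "s \<ge> 1" and k: "k \<noteq> 0" and e: "0 < \<epsilon>"
    and lower: "\<And>n. n \<ge> 1 \<Longrightarrow> ereal (c / (real n + \<bar>real_of_int k\<bar>) ^ s) \<le> error_periodic n k s"
    and B: "error_sobolev 0 k s \<le> ereal B"
  shows "c / (real (n_nor \<epsilon> k s) + 1 + \<bar>real_of_int k\<bar>) ^ s \<le> \<epsilon> * B"
proof -
  let ?n = "n_nor \<epsilon> k s"
  have "ereal (c / (real (Suc ?n) + \<bar>real_of_int k\<bar>) ^ s) \<le> error_sobolev (Suc ?n) k s"
    using lower[of "Suc ?n"] error_periodic_le_error_sobolev by (simp add: order_trans)
  also have "\<dots> \<le> error_sobolev ?n k s"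
    by (rule error_sobolev_antimono[OF s]) simp
  also have "\<dots> \<le> ereal \<epsilon> * error_sobolev 0 k s"
    by (rule n_nor_attained[OF s k e])
  also have "\<dots> \<le> ereal \<epsilon> * ereal B"
    using e B by (intro ereal_mult_left_mono) auto
  finally show ?thesis by (simp add: add_ac)
qed

text \<open>
  With \<open>K = |k|\<close>, both bounds compare \<open>s\<close>-th powers. The lower bound says that \<open>(n + 1 + K) ^ s\<close>
  is at least a constant times \<open>K / \<epsilon>\<close>; for small \<open>\<epsilon>\<close> the shift \<open>1 + K\<close> is absorbed by
  halving the constant. The upper bound takes the number \<open>m\<close> of Taylor intervals so large that
  \<open>m ^ s\<close> exceeds \<open>4 pi K / \<epsilon>\<close>.
\<close>

lemma n_nor_asymptotics:
  assumes s: "s \<ge> 1" and c: "c > 0"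
    and lower: "\<And>k n. n \<ge> 1 \<Longrightarrow> ereal (c / (real n + \<bar>real_of_int k\<bar>) ^ s) \<le> error_periodic n k s"
  shows "\<exists>C1>0. \<exists>C2>0. \<forall>k::int. k \<noteq> 0 \<longrightarrow>
        (\<forall>\<^sub>F \<epsilon> in at_right 0.
           C1 * (\<bar>real_of_int k\<bar> powr (1 / real s) * \<epsilon> powr (- 1 / real s)) \<le> real (n_nor \<epsilon> k s) \<and>
           real (n_nor \<epsilon> k s) \<le> C2 * (\<bar>real_of_int k\<bar> powr (1 / real s) * \<epsilon> powr (- 1 / real s)))"
proof -
  define a where "a = (pi * c / real s) powr (1 / real s)"
  define b where "b = (4 * pi) powr (1 / real s)"
  have a: "a > 0" "a ^ s = pi * c / real s"
    using s c by (auto simp: a_def powr_powr simp flip: powr_realpow)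
  have b: "b > 0" "b ^ s = 4 * pi"
    using s by (auto simp: b_def powr_powr simp flip: powr_realpow)
  show ?thesis
  proof (rule exI[of _ "a / 2"], intro conjI, goal_cases)
    case 1 show ?case using a by simp
  next
    case 2
    show ?case
    proof (rule exI[of _ "2 * real s * b"], intro conjI allI impI, goal_cases)
      case 1 show ?case using b s by simp
    next
      case (2 k)
      define K where "K = \<bar>real_of_int k\<bar>"
      have K: "K > 0" using 2 by (simp add: K_def)
      \<comment> \<open>Once \<open>Q \<ge> C\<close>, the shift \<open>1 + K\<close> is at most half of \<open>a * Q\<close>, and rounding \<open>b * Q\<close> up
          at most doubles it.\<close>
      define C where "C = max (2 * (1 + K) / a) (1 / b)"
      have "2 * (1 + K) / a \<le> C" "1 / b \<le> C" by (auto simp: C_def)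
      then have C: "a * C \<ge> 2 * (1 + K)" "b * C \<ge> 1"
        using a(1) b(1) by (auto simp: field_simps)
      have C0: "C > 0" using b(1) by (auto simp: C_def intro: less_max_iff_disj[THEN iffD2])
      have "\<forall>\<^sub>F \<epsilon> in at_right 0. \<epsilon> \<in> {0<..<K / C ^ s}"
        using K C0 by (intro eventually_at_right_real) auto
      then show ?case
      proof eventually_elim
        case (elim \<epsilon>)
        then have e: "0 < \<epsilon>" "\<epsilon> < K / C ^ s" by auto
        define Q where "Q = K powr (1 / real s) * \<epsilon> powr (- 1 / real s)"
        have Q: "Q > 0" using K e by (simp add: Q_def)
        have "\<epsilon> powr (- 1 / real s) = inverse (\<epsilon> powr (1 / real s))"
          by (metis minus_divide_left powr_minus)
        then have "Q = (K / \<epsilon>) powr (1 / real s)"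
          using powr_divide[of K \<epsilon> "1 / real s"] K e by (simp add: Q_def divide_inverse[symmetric])
        then have Qs: "Q ^ s = K / \<epsilon>"
          using s K e by (simp add: powr_powr flip: powr_realpow)
        have "C ^ s \<le> Q ^ s"
          using e C0 K by (simp add: Qs field_simps)
        then have CQ: "C \<le> Q"
          using power_mono_iff[of C Q s] C0 Q s by simp
        let ?n = "real (n_nor \<epsilon> k s)"
        have lo: "a / 2 * Q \<le> ?n"
        proof -
          have "c / (?n + 1 + K) ^ s \<le> \<epsilon> * (real s / (pi * K))"
            unfolding K_def using 2 by (intro n_nor_lower_bound[OF s _ e(1) lower] initial_error_le s) auto
          then have "pi * c / real s * (K / \<epsilon>) \<le> (?n + 1 + K) ^ s"
            using e s K by (simp add: field_simps)
          then have "(a * Q) ^ s \<le> (?n + 1 + K) ^ s"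
            by (simp add: power_mult_distrib a(2) Qs)
          then have "a * Q \<le> ?n + 1 + K"
            using power_mono_iff[of "a * Q" "?n + 1 + K" s] a Q K s by simp
          moreover have "2 * (1 + K) \<le> a * Q"
            using C(1) CQ a(1) by (meson mult_left_mono less_imp_le order_trans)
          ultimately show ?thesis by simp
        qed
        have up: "?n \<le> 2 * real s * b * Q"
        proof -
          define m where "m = nat \<lceil>b * Q\<rceil>"
          have bQ: "1 \<le> b * Q"
            using C(2) CQ b(1) by (meson mult_left_mono less_imp_le order_trans)
          have m: "b * Q \<le> real m" "real m \<le> b * Q + 1" "m \<ge> 1"
            using bQ unfolding m_def by linarith+
          have "(1 / real m) ^ s \<le> (1 / (b * Q)) ^ s"
            using m bQ b(1) Q by (intro power_mono divide_left_mono mult_pos_pos) auto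
          also have "\<dots> = \<epsilon> / (4 * pi * K)"
            using e K by (simp add: power_divide power_mult_distrib b Qs)
          finally have "n_nor \<epsilon> k s \<le> m * s"
            unfolding K_def using 2 by (intro n_nor_le[OF s _ e(1) error_sobolev_taylor_le[OF s m(3)]]) auto
          then have "?n \<le> real m * real s" by (metis of_nat_le_iff of_nat_mult)
          also have "\<dots> \<le> (2 * (b * Q)) * real s"
            using m bQ by (intro mult_right_mono) auto
          finally show ?thesis by (simp add: mult_ac)
        qed
        from lo up show ?case by (simp add: Q_def K_def)
      qed
    qed
  qed
qed

text \<open>
  The lower bound \<open>c / (n + |k|)\<close> and the bound \<open>1 / (sqrt 2 pi |k|)\<close> on the initial error decay at the same rate in
  \<open>|k|\<close>. Below the threshold the former exceeds \<open>\<epsilon>\<close> times the latter by a fixed factor unless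
  \<open>n\<close> grows at least linearly in \<open>|k|\<close>.
\<close>

lemma n_nor_tendsto_infinity_smoothness_1:
  assumes lower: "\<And>k n. n \<ge> 1 \<Longrightarrow> ereal (c / (real n + \<bar>real_of_int k\<bar>)) \<le> error_periodic n k 1"
    and e: "0 < \<epsilon>" "\<epsilon> < sqrt 2 * pi * c"
  shows "filterlim (\<lambda>k. n_nor \<epsilon> k 1) at_top abs_at_top"
  unfolding filterlim_at_top
proof
  fix N :: nat
  define d where "d = sqrt 2 * pi * c - \<epsilon>"
  have d: "d > 0" using e by (simp add: d_def)
  define M where "M = max 1 \<lceil>(real N + 1) * \<epsilon> / d\<rceil>"
  show "\<forall>\<^sub>F k in abs_at_top. N \<le> n_nor \<epsilon> k 1"
    unfolding eventually_filtercomap_at_top_linorder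
  proof (intro exI[of _ M] allI impI)
    fix k :: int assume k: "M \<le> \<bar>k\<bar>"
    let ?K = "\<bar>real_of_int k\<bar>" and ?n = "real (n_nor \<epsilon> k 1)"
    have "\<lceil>(real N + 1) * \<epsilon> / d\<rceil> \<le> \<bar>k\<bar>" "1 \<le> \<bar>k\<bar>" using k by (auto simp: M_def)
    then have K: "(real N + 1) * \<epsilon> / d \<le> ?K" "k \<noteq> 0" by (auto simp: ceiling_le_iff)
    have "c / (?n + 1 + ?K) \<le> \<epsilon> * (1 / (sqrt 2 * pi * ?K))"
      using n_nor_lower_bound[OF order_refl K(2) e(1) _ initial_error_le_smoothness_1[OF K(2)], of c] lower by simp
    then have "sqrt 2 * pi * c * ?K \<le> \<epsilon> * (?n + 1 + ?K)"
      using K(2) by (simp add: field_simps)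
    then have "d * ?K \<le> \<epsilon> * (?n + 1)" by (simp add: d_def algebra_simps)
    moreover have "(real N + 1) * \<epsilon> \<le> d * ?K" using K(1) d by (simp add: field_simps)
    ultimately have "\<epsilon> * (real N + 1) \<le> \<epsilon> * (?n + 1)" by (simp add: mult.commute)
    then show "N \<le> n_nor \<epsilon> k 1" using e(1) by simp
  qed
qed

text \<open>
  The algorithm at the end points has error of order \<open>|k| ^ (-s)\<close>, whereas the normalized criterion
  only asks for the order \<open>|k| powr (- 1 - \<eta>)\<close>. The condition on \<open>\<eta>\<close> says that the former decays faster,
  and \<open>\<delta>\<close> is the gap between the exponents.
\<close>

lemma n_nor_le_endpoints:
  fixes \<epsilon> :: "int \<Rightarrow> real"
  assumes s: "s \<ge> 1" and e: "\<And>k. 0 < \<epsilon> k" and \<eta>: "\<eta> < real s - 1" and C: "C > 0"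
    and bound: "\<forall>\<^sub>F k in abs_at_top. inverse (\<epsilon> k) \<le> C * \<bar>real_of_int k\<bar> powr \<eta>"
  shows "\<forall>\<^sub>F k in abs_at_top. n_nor (\<epsilon> k) k s \<le> 2 * s"
proof -
  define \<delta> where "\<delta> = real s - 1 - \<eta>"
  have \<delta>: "\<delta> > 0" using \<eta> by (simp add: \<delta>_def)
  define M where "M = max 1 \<lceil>(4 * pi * C) powr (1 / \<delta>)\<rceil>"
  have "\<forall>\<^sub>F k in abs_at_top. M \<le> \<bar>k\<bar>"
    unfolding eventually_filtercomap_at_top_linorder by blast
  with bound show ?thesis
  proof eventually_elim
    case (elim k)
    let ?K = "\<bar>real_of_int k\<bar>"
    have "\<lceil>(4 * pi * C) powr (1 / \<delta>)\<rceil> \<le> \<bar>k\<bar>" "1 \<le> \<bar>k\<bar>" using elim by (auto simp: M_def)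
    then have K: "(4 * pi * C) powr (1 / \<delta>) \<le> ?K" "1 \<le> ?K" "k \<noteq> 0" by (auto simp: ceiling_le_iff)
    have "4 * pi * C = ((4 * pi * C) powr (1 / \<delta>)) powr \<delta>"
      using C \<delta> by (simp add: powr_powr)
    also have "\<dots> \<le> ?K powr \<delta>"
      using K \<delta> by (intro powr_mono2) auto
    finally have KC: "4 * pi * C \<le> ?K powr \<delta>" .
    have "4 * pi * ?K * inverse (\<epsilon> k) \<le> 4 * pi * ?K * (C * ?K powr \<eta>)"
      using elim(1) by (intro mult_left_mono) auto
    also have "\<dots> = (4 * pi * C) * (?K powr 1 * ?K powr \<eta>)"
      using K by simp
    also have "\<dots> \<le> ?K powr \<delta> * (?K powr 1 * ?K powr \<eta>)"
      using KC by (intro mult_right_mono) auto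
    also have "\<dots> = ?K powr real s"
      unfolding powr_add[symmetric] by (simp add: \<delta>_def)
    also have "\<dots> = ?K ^ s" using K by (simp add: powr_realpow)
    also have "\<dots> \<le> (2 * pi * ?K) ^ s"
      using pi_ge_two K(2) mult_right_mono[of 1 "2 * pi" ?K] by (intro power_mono) auto
    finally have "4 * pi * ?K * inverse (\<epsilon> k) \<le> (2 * pi * ?K) ^ s" .
    moreover have "0 < 4 * pi * ?K * inverse (\<epsilon> k)" using K e[of k] by simp
    ultimately have "1 / (2 * pi * ?K) ^ s \<le> 1 / (4 * pi * ?K * inverse (\<epsilon> k))"
      by (intro frac_le) auto
    also have "\<dots> = \<epsilon> k / (4 * pi * ?K)" using e[of k] by (simp add: field_simps)
    finally show ?case
      by (intro n_nor_le[OF s K(3) e error_sobolev_endpoints_le[OF s K(3)]])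
  qed
qed

theorem corollary18:
  fixes c :: "nat \<Rightarrow> real"
  assumes c_pos: "\<And>s. s \<ge> 1 \<Longrightarrow> c s > 0"
    and lower_bound: "\<And>s k n. s \<ge> 1 \<Longrightarrow> n \<ge> 1 \<Longrightarrow>
           ereal (c s / (real n + \<bar>real_of_int k\<bar>) ^ s) \<le> error_periodic n k s"
  shows
    "(\<forall>s\<ge>1. \<exists>C1>0. \<exists>C2>0. \<forall>k::int. k \<noteq> 0 \<longrightarrow>
        (\<forall>\<^sub>F \<epsilon> in at_right 0.
           C1 * (\<bar>real_of_int k\<bar> powr (1 / real s) * \<epsilon> powr (- 1 / real s)) \<le> real (n_nor \<epsilon> k s) \<and>
           real (n_nor \<epsilon> k s) \<le> C2 * (\<bar>real_of_int k\<bar> powr (1 / real s) * \<epsilon> powr (- 1 / real s))))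
     \<and>
     (\<forall>\<epsilon>. 0 < \<epsilon> \<and> \<epsilon> < 1 \<and> \<epsilon> < sqrt 2 * pi * c 1 \<longrightarrow>
        filterlim (\<lambda>k. n_nor \<epsilon> k 1) at_top abs_at_top)
     \<and>
     (\<forall>s\<ge>2.
        (\<forall>\<epsilon>. 0 < \<epsilon> \<and> \<epsilon> < 1 \<longrightarrow> (\<forall>\<^sub>F k in abs_at_top. n_nor \<epsilon> k s \<le> 2 * s)) \<and>
        (\<forall>(\<epsilon> :: int \<Rightarrow> real) \<eta>.
           (\<forall>k. 0 < \<epsilon> k \<and> \<epsilon> k < 1) \<and> 0 < \<eta> \<and> \<eta> < real s - 1 \<and>
           (\<lambda>k. inverse (\<epsilon> k)) \<in> O[abs_at_top](\<lambda>k. \<bar>real_of_int k\<bar> powr \<eta>) \<longrightarrow>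
           (\<forall>\<^sub>F k in abs_at_top. n_nor (\<epsilon> k) k s \<le> 2 * s)))"
proof (intro conjI allI impI, goal_cases)
  case (1 s)
  then show ?case by (intro n_nor_asymptotics[of s "c s"] c_pos lower_bound)
next
  case (2 \<epsilon>)
  then show ?case using n_nor_tendsto_infinity_smoothness_1[of "c 1" \<epsilon>] lower_bound[of 1] by simp
next
  case (3 s \<epsilon>)
  \<comment> \<open>A constant tolerance obeys the growth condition with exponent \<open>0\<close>.\<close>
  have "\<forall>\<^sub>F k::int in abs_at_top. 1 \<le> \<bar>k\<bar>"
    unfolding eventually_filtercomap_at_top_linorder by blast
  then have "\<forall>\<^sub>F k in abs_at_top. inverse \<epsilon> \<le> inverse \<epsilon> * \<bar>real_of_int k\<bar> powr 0"
    by eventually_elim auto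
  then show ?case using 3 by (intro n_nor_le_endpoints[of s _ 0 "inverse \<epsilon>"]) auto
next
  case (4 s \<epsilon> \<eta>)
  then have "(\<lambda>k. inverse (\<epsilon> k)) \<in> O[abs_at_top](\<lambda>k. \<bar>real_of_int k\<bar> powr \<eta>)" by blast
  then obtain C where C: "C > 0"
    "\<forall>\<^sub>F k in abs_at_top. norm (inverse (\<epsilon> k)) \<le> C * norm (\<bar>real_of_int k\<bar> powr \<eta>)"
    by (elim landau_o.bigE)
  have pos: "0 < \<epsilon> k" for k using 4 by blast
  from C(2) have "\<forall>\<^sub>F k in abs_at_top. inverse (\<epsilon> k) \<le> C * \<bar>real_of_int k\<bar> powr \<eta>"
    by eventually_elim (simp add: abs_of_pos[OF pos])
  then show ?case using 4 C(1) by (intro n_nor_le_endpoints[of s \<epsilon> \<eta> C]) auto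
qed

end
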